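(* Let $\{a_i\}_{i\ge 1}$ be free, identically distributed self-adjoint variables in $(\mathcal{A},\varphi)$ and, for each $n\ge 1$, let $N_n$ be a non-negative integer-valued random variable with all moments finite, independent of $\{a_i\}$. Let $s$ be a standard semi-circle variable, independent of $N_n$. (i) Let $\varphi(a_1)\neq 0$. Suppose that as $n\to\infty$, $\eta_n\to\infty$, $\sigma_n^2\to\infty$ and $\mathbb{E}[|N_n-\eta_n|^m]=O(\sigma_n^m)$ for all $m\in\mathbb{N}$. Then, as $n\to\infty$, $$\tilde{\varphi}\big(\tilde{\mathcal{S}}_{N_n}^m(\delta_n\tilde{N}_n)^l\big)=\tilde{\varphi}\Big[\big(\delta_n\tilde{N}_n\cdot 1_{\mathcal{A}}+\sqrt{1-\delta_n^2}\,s\big)^m(\delta_n\tilde{N}_n)^l\Big]+o(1)\quad\text{for all } m,l\in\mathbb{N}\cup\{0\}.$$ (ii) Let $\varphi(a_1)=0$. Suppose that as $n\to\infty$, $\eta_n\to\infty$ and $\limsup_{n\to\infty}\mathbb{E}\big[(N_n/\eta_n)^m\big]<\infty$ for all $m\in\mathbb{N}$. Then, for each $m,l\in\mathbb{N}\cup\{0\}$, as $n\to\infty$, $$\tilde{\varphi}\Big[\tilde{\mathcal{S}}_{N_n}^m\Big(\frac{N_n}{\eta_n}\Big)^l\Big]=\mathbb{E}\Big[\Big(\frac{N_n}{\eta_n}\Big)^{l+\frac m2}\Big]\varphi(s^m)+o(1).$$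
   Context: $(\mathcal{A},\varphi)$ is a $*$-probability space: a unital $*$-algebra with unit $1_{\mathcal{A}}$ and a positive linear functional $\varphi$ with $\varphi(1_{\mathcal{A}})=1$. "Free" means freely independent; "identically distributed" means $\varphi(a_i^m)=\varphi(a_1^m)$ for all $i,m$. Notation: $\alpha=\varphi(a_1)$, $\theta^2=\varphi(a_1^2)-\alpha^2\ge 0$ (in part (ii), $\theta>0$); $\eta_n=\mathbb{E}[N_n]$, $\gamma_n^2=\mathbb{V}\mathrm{ar}(N_n)$, $\sigma_n^2=\eta_n\theta^2+\gamma_n^2\alpha^2$. $\mathcal{S}_k=a_1+\cdots+a_k$, $\mathcal{S}_0=0$, and $\mathcal{S}_{N_n}=a_1+\cdots+a_{N_n}$ is the random sum. Put $\tilde{N}_n=(N_n-\eta_n)/\gamma_n$, $\tilde{\mathcal{S}}_{N_n}=(\mathcal{S}_{N_n}-\eta_n\alpha)/\sigma_n$, $\delta_n=\gamma_n\alpha/\sigma_n$; thus $\delta_n\tilde N_n=\alpha(N_n-\eta_n)/\sigma_n$ (this is taken as its meaning when $\gamma_n=0$). The random sums live in a larger non-commutative probability space with state $\tilde\varphi=\mathbb{E}\varphi$, in which $N_n$ is independent of $\mathcal{A}$ (and central): for a polynomial $P$ and a real function $f$, $\tilde\varphi\big(P(\mathcal{S}_{N_n})f(N_n)\big)=\sum_{i\ge0}\mathbb{P}\{N_n=i\}f(i)\,\varphi(P(\mathcal{S}_i))$. A standard semi-circle variable $s$ is a self-adjoint variable whose moments $\varphi(s^m)$ are those of the density $\frac{1}{2\pi}\sqrt{4-x^2}$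 on $[-2,2]$. Independence of $s$ and $N_n$ means they commute and $\tilde\varphi(s^k f(N_n))=\varphi(s^k)\mathbb{E}[f(N_n)]$, so the right side of (i) is $\sum_{r=0}^m\binom mr(1-\delta_n^2)^{(m-r)/2}\varphi(s^{m-r})\mathbb{E}[(\delta_n\tilde N_n)^{r+l}]$ up to $o(1)$. *)

theory Defs
  imports "HOL-Probability.Probability"
begin

section \<open>Star-probability spaces and free independence\<close>

text \<open>
  The scalar multiplication, the involution and the state are explicit parameters; the underlying
  ring is a type of class \<open>ring_1\<close>.  The axiom \<open>0 \<noteq> 1\<close> of that class costs no generality, since
  \<open>phi 0 = 0\<close> and \<open>phi 1 = 1\<close>.
\<close>

locale star_algebra = vector_space scaleC
  for scaleC :: "complex \<Rightarrow> 'a::ring_1 \<Rightarrow> 'a" +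
  fixes adj :: "'a \<Rightarrow> 'a"
  assumes scaleC_mult_left: "scaleC c x * y = scaleC c (x * y)"
    and scaleC_mult_right: "x * scaleC c y = scaleC c (x * y)"
    and adj_add: "adj (x + y) = adj x + adj y"
    and adj_scaleC: "adj (scaleC c x) = scaleC (cnj c) (adj x)"
    and adj_mult: "adj (x * y) = adj y * adj x"
    and adj_adj: "adj (adj x) = x"

locale star_prob_space = star_algebra scaleC adj
  for scaleC :: "complex \<Rightarrow> 'a::ring_1 \<Rightarrow> 'a" and adj :: "'a \<Rightarrow> 'a" +
  fixes phi :: "'a \<Rightarrow> complex"
  assumes phi_linear: "Vector_Spaces.linear scaleC (*) phi"
    and phi_positive: "phi (adj x * x) \<in> \<real>\<^sub>\<ge>\<^sub>0"
    and phi_one: "phi 1 = 1"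

definition unital_star_subalgebra ::
    "(complex \<Rightarrow> 'a::ring_1 \<Rightarrow> 'a) \<Rightarrow> ('a \<Rightarrow> 'a) \<Rightarrow> 'a set \<Rightarrow> bool" where
  "unital_star_subalgebra scaleC adj B \<longleftrightarrow>
     1 \<in> B \<and> (\<forall>x\<in>B. \<forall>y\<in>B. x + y \<in> B \<and> x * y \<in> B) \<and> (\<forall>c. \<forall>x\<in>B. scaleC c x \<in> B) \<and>
     (\<forall>x\<in>B. adj x \<in> B)"

definition generated_star_subalgebra ::
    "(complex \<Rightarrow> 'a::ring_1 \<Rightarrow> 'a) \<Rightarrow> ('a \<Rightarrow> 'a) \<Rightarrow> 'a set \<Rightarrow> 'a set" where
  "generated_star_subalgebra scaleC adj X =
     \<Inter>{B. unital_star_subalgebra scaleC adj B \<and> X \<subseteq> B}"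

text \<open>
  Free independence of the family \<open>(B i)\<close>, \<open>i \<in> I\<close>, of unital subalgebras: \<open>phi (x\<^sub>1 \<dots> x\<^sub>p) = 0\<close>
  whenever every \<open>x\<^sub>k\<close> is a centred element of \<open>B j\<^sub>k\<close> and neighbouring indices \<open>j\<^sub>k\<close> differ.
\<close>

definition free_subalgebras ::
    "('a::ring_1 \<Rightarrow> complex) \<Rightarrow> 'i set \<Rightarrow> ('i \<Rightarrow> 'a set) \<Rightarrow> bool" where
  "free_subalgebras phi I B \<longleftrightarrow>
     (\<forall>js xs. js \<noteq> [] \<and> length xs = length js \<and> set js \<subseteq> I \<and> distinct_adj js \<and>
        (\<forall>k<length js. xs ! k \<in> B (js ! k) \<and> phi (xs ! k) = 0)
        \<longrightarrow> phi (prod_list xs) = 0)"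

definition free_variables ::
    "(complex \<Rightarrow> 'a::ring_1 \<Rightarrow> 'a) \<Rightarrow> ('a \<Rightarrow> 'a) \<Rightarrow> ('a \<Rightarrow> complex) \<Rightarrow> 'i set \<Rightarrow> ('i \<Rightarrow> 'a) \<Rightarrow> bool"
  where
  "free_variables scaleC adj phi I a \<longleftrightarrow>
     free_subalgebras phi I (\<lambda>i. generated_star_subalgebra scaleC adj {a i})"

definition semicircle_density :: "real \<Rightarrow> real" where
  "semicircle_density x = 1 / (2 * pi) * sqrt (4 - x\<^sup>2)"

definition standard_semicircular :: "('a::ring_1 \<Rightarrow> 'a) \<Rightarrow> ('a \<Rightarrow> complex) \<Rightarrow> 'a \<Rightarrow> bool" where
  "standard_semicircular adj phi s \<longleftrightarrow>
     adj s = s \<and>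
     (\<forall>m::nat. phi (s ^ m) = of_real (LINT x:{-2..2}|lborel. x ^ m * semicircle_density x))"


section \<open>Random elements and the state \<open>\<bbbE> phi\<close>\<close>

text \<open>
  The larger non-commutative probability space consists of algebra-valued functions \<open>X\<close> on the
  sample space, with pointwise operations and the state \<open>\<bbbE> phi\<close>.  The algebra sits in it as the
  constant functions and a real random variable \<open>Y\<close> as the function \<open>w \<mapsto> Y w \<cdot> 1\<close>; hence
  classical random variables are central and independent of the algebra.
  For functions \<open>X w = Z (K w)\<close> of a discrete random variable \<open>K\<close> the state is the series
  in \<open>ext_state_sums\<close> below.
\<close>

definition ext_state :: "'w measure \<Rightarrow> ('a \<Rightarrow> complex) \<Rightarrow> ('w \<Rightarrow> 'a) \<Rightarrow> complex" where
  "ext_state M phi X = (\<integral>w. phi (X w) \<partial>M)"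

definition scalar_elem :: "(complex \<Rightarrow> 'a::ring_1 \<Rightarrow> 'a) \<Rightarrow> real \<Rightarrow> 'a" where
  "scalar_elem scaleC r = scaleC (complex_of_real r) 1"

lemma ext_state_sums:
  assumes "prob_space M" and K [measurable]: "K \<in> measurable M (count_space (UNIV :: nat set))"
    and int: "integrable M (\<lambda>w. phi (Z (K w)))"
  shows "(\<lambda>i. complex_of_real (measure M {w \<in> space M. K w = i}) * phi (Z i))
           sums ext_state M phi (\<lambda>w. Z (K w))"
proof -
  interpret prob_space M by fact
  define p where "p i = measure M {w \<in> space M. K w = i}" for i
  let ?C = "count_space (UNIV :: nat set)"
  have D: "distr M ?C K = density ?C (\<lambda>i. ennreal (p i))"
  proof (rule measure_eqI_countable[where A = UNIV])
    fix i :: nat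
    have "emeasure (distr M ?C K) {i} = emeasure M {w \<in> space M. K w = i}"
      by (subst emeasure_distr) (auto intro!: arg_cong[where f = "emeasure M"])
    also have "\<dots> = ennreal (p i)"
      by (simp add: p_def emeasure_eq_measure)
    also have "\<dots> = emeasure (density ?C (\<lambda>i. ennreal (p i))) {i}"
      by (simp add: emeasure_density nn_integral_count_space_indicator[symmetric]
          nn_integral_count_space_finite)
    finally show "emeasure (distr M ?C K) {i} = emeasure (density ?C (\<lambda>i. ennreal (p i))) {i}" .
  qed auto
  have p: "AE i in ?C. 0 \<le> p i"
    by (simp add: p_def)
  have "integrable (distr M ?C K) (\<lambda>i. phi (Z i))"
    using int by (subst integrable_distr_eq) auto
  then have "integrable ?C (\<lambda>i. p i *\<^sub>R phi (Z i))"
    unfolding D using p by (subst (asm) integrable_density) auto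
  from sums_integral_count_space_nat[OF this]
  have "(\<lambda>i. p i *\<^sub>R phi (Z i)) sums integral\<^sup>L (distr M ?C K) (\<lambda>i. phi (Z i))"
    unfolding D using p by (subst integral_density) auto
  also have "integral\<^sup>L (distr M ?C K) (\<lambda>i. phi (Z i)) = ext_state M phi (\<lambda>w. Z (K w))"
    by (subst integral_distr) (auto simp: ext_state_def)
  finally show ?thesis
    by (simp add: p_def scaleR_conv_of_real)
qed


section \<open>Random sums\<close>

text \<open>
  Sequences are indexed from \<open>1\<close>; \<open>a 0\<close> is never used.  States take complex values, but
  \<open>phi x\<close> is real for self-adjoint \<open>x\<close>, so \<open>Re\<close> loses nothing in \<open>rs_alpha\<close> and \<open>rs_theta\<close>.
\<close>

definition rs_alpha :: "('a::ring_1 \<Rightarrow> complex) \<Rightarrow> (nat \<Rightarrow> 'a) \<Rightarrow> real" where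
  "rs_alpha phi a = Re (phi (a 1))"

definition rs_theta :: "('a::ring_1 \<Rightarrow> complex) \<Rightarrow> (nat \<Rightarrow> 'a) \<Rightarrow> real" where
  "rs_theta phi a = sqrt (Re (phi ((a 1)\<^sup>2)) - (rs_alpha phi a)\<^sup>2)"

definition rs_eta :: "'w measure \<Rightarrow> (nat \<Rightarrow> 'w \<Rightarrow> nat) \<Rightarrow> nat \<Rightarrow> real" where
  "rs_eta M N n = prob_space.expectation M (\<lambda>w. real (N n w))"

definition rs_gamma :: "'w measure \<Rightarrow> (nat \<Rightarrow> 'w \<Rightarrow> nat) \<Rightarrow> nat \<Rightarrow> real" where
  "rs_gamma M N n = sqrt (prob_space.variance M (\<lambda>w. real (N n w)))"

definition rs_sigma ::
    "('a::ring_1 \<Rightarrow> complex) \<Rightarrow> (nat \<Rightarrow> 'a) \<Rightarrow> 'w measure \<Rightarrow> (nat \<Rightarrow> 'w \<Rightarrow> nat) \<Rightarrow> nat \<Rightarrow> real"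
  where
  "rs_sigma phi a M N n =
     sqrt (rs_eta M N n * (rs_theta phi a)\<^sup>2 + (rs_gamma M N n)\<^sup>2 * (rs_alpha phi a)\<^sup>2)"

definition rs_delta ::
    "('a::ring_1 \<Rightarrow> complex) \<Rightarrow> (nat \<Rightarrow> 'a) \<Rightarrow> 'w measure \<Rightarrow> (nat \<Rightarrow> 'w \<Rightarrow> nat) \<Rightarrow> nat \<Rightarrow> real"
  where
  "rs_delta phi a M N n = rs_gamma M N n * rs_alpha phi a / rs_sigma phi a M N n"

definition rs_N_tilde :: "'w measure \<Rightarrow> (nat \<Rightarrow> 'w \<Rightarrow> nat) \<Rightarrow> nat \<Rightarrow> 'w \<Rightarrow> real" where
  "rs_N_tilde M N n w = (real (N n w) - rs_eta M N n) / rs_gamma M N n"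

text \<open>
  The product of \<open>rs_delta\<close> and \<open>rs_N_tilde\<close>, in the form that also makes sense when
  \<open>rs_gamma M N n = 0\<close>.
\<close>

definition rs_delta_N_tilde ::
    "('a::ring_1 \<Rightarrow> complex) \<Rightarrow> (nat \<Rightarrow> 'a) \<Rightarrow> 'w measure \<Rightarrow> (nat \<Rightarrow> 'w \<Rightarrow> nat) \<Rightarrow> nat \<Rightarrow> 'w \<Rightarrow> real"
  where
  "rs_delta_N_tilde phi a M N n w =
     rs_alpha phi a * (real (N n w) - rs_eta M N n) / rs_sigma phi a M N n"

lemma rs_delta_N_tilde_eq:
  assumes "rs_gamma M N n \<noteq> 0"
  shows "rs_delta_N_tilde phi a M N n w = rs_delta phi a M N n * rs_N_tilde M N n w"
  using assms by (simp add: rs_delta_N_tilde_def rs_delta_def rs_N_tilde_def)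

definition partial_sum :: "(nat \<Rightarrow> 'a::ring_1) \<Rightarrow> nat \<Rightarrow> 'a" where
  "partial_sum a k = (\<Sum>i=1..k. a i)"

definition rs_S_tilde ::
    "(complex \<Rightarrow> 'a::ring_1 \<Rightarrow> 'a) \<Rightarrow> ('a \<Rightarrow> complex) \<Rightarrow> (nat \<Rightarrow> 'a) \<Rightarrow>
     'w measure \<Rightarrow> (nat \<Rightarrow> 'w \<Rightarrow> nat) \<Rightarrow> nat \<Rightarrow> 'w \<Rightarrow> 'a"
  where
  "rs_S_tilde scaleC phi a M N n w =
     scaleC (complex_of_real (1 / rs_sigma phi a M N n))
       (partial_sum a (N n w) - scalar_elem scaleC (rs_eta M N n * rs_alpha phi a))"

text \<open>
  Real powers of \<open>x \<ge> 0\<close> with \<open>0\<^sup>0 = 1\<close>; \<open>(powr)\<close> has \<open>0 powr 0 = 0\<close>, which would be wrong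
  for \<open>N\<^sub>n = 0\<close> and exponent \<open>l + m / 2 = 0\<close>.
\<close>

definition rpow :: "real \<Rightarrow> real \<Rightarrow> real" where
  "rpow x p = (if p = 0 then 1 else x powr p)"

end

theory Submission
  imports Defs
begin

text \<open>
  Write \<open>T\<^sub>k\<close> for the sum of the first \<open>k\<close> centred variables and \<open>\<mu>\<^sub>r\<close> for the moments of the semicircle
  law.  Expanding \<open>phi (T\<^sub>k ^ r)\<close> over words in \<open>k\<close> letters, freeness annihilates every word with a
  letter occurring once, and evaluates a word in which each letter occurs twice exactly as for free
  semicircular variables; these contribute \<open>\<mu>\<^sub>r (\<theta> sqrt k) ^ r\<close>.  The remaining words use at
  most \<open>(r - 1) div 2\<close> letters and have bounded moments, so
  \<open>phi (T\<^sub>k ^ r) = \<mu>\<^sub>r (\<theta> sqrt k) ^ r + O(k ^ ((r - 1) div 2))\<close>.  Inserting \<open>k = N\<^sub>n\<close> and expanding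
  the \<open>m\<close>-th power binomially, the two sides differ pointwise by a fixed multiple of
  \<open>(1 + \<bar>\<delta>\<^sub>n N~\<^sub>n\<bar>) ^ (m + l) / \<sigma>\<^sub>n\<close> in part (i) and of
  \<open>(N\<^sub>n / \<eta>\<^sub>n) ^ j / sqrt \<eta>\<^sub>n\<close> for some \<open>j\<close> in part (ii), and the moment hypotheses bound the expectations.
\<close>

section \<open>Moments of the semicircle law\<close>

text \<open>The semicircle law enters through its density, so its moments are tied to the sums over
  words by a common convolution recursion and not through an enumeration of non-crossing pairings.
  The exponent (r - 1) div 2 supplies the gain: for d of this size 2 d + 1 <= r, so division by the
  r-th power of the normalization absorbs k^d and leaves at least one factor of order 1/\<sigma>.
  Part (i) also replaces the random k by \<eta>. With c the value of \<delta> N~, one has k - \<eta>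
  = \<sigma> c / \<alpha>, so after division by \<sigma>^2 again one factor 1/\<sigma> is left; this
  is where \<alpha> must not vanish. The size of k / \<sigma>^2 is controlled through \<eta>
  \<theta>^2 <= \<sigma>^2, which says nothing about \<eta> if \<theta> = 0. In that case the
  centred moments are shown to vanish exactly, by Cauchy-Schwarz. In part (ii) N / \<eta> need not
  concentrate near 1, so k stays in the main term.\<close>

lemma set_lborel_integral_FTC:
  fixes F f :: "real \<Rightarrow> real"
  assumes "a \<le> b" "continuous_on {a..b} F" "continuous_on {a..b} f"
    and "\<And>x. x \<in> {a<..<b} \<Longrightarrow> (F has_real_derivative f x) (at x)"
  shows "(LINT x:{a..b}|lborel. f x) = F b - F a"
proof -
  have "(f has_integral (F b - F a)) {a..b}"
    using assms by (intro fundamental_theorem_of_calculus_interior)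
      (auto simp: has_real_derivative_iff_has_vector_derivative)
  moreover have "set_integrable lborel {a..b} f"
    using assms(3) by (rule borel_integrable_atLeastAtMost')
  ultimately show ?thesis
    by (simp add: set_borel_integral_eq_integral(2) integral_unique)
qed

definition semicircle_moment :: "nat \<Rightarrow> real" where
  "semicircle_moment m = (LINT x:{-2..2}|lborel. x ^ m * semicircle_density x)"

lemma continuous_on_semicircle_density [continuous_intros]:
  "continuous_on A f \<Longrightarrow> continuous_on A (\<lambda>x. semicircle_density (f x))"
  unfolding semicircle_density_def by (intro continuous_intros)

lemma four_minus_square_pos: "x \<in> {-2<..<2} \<Longrightarrow> 0 < 4 - x\<^sup>2" for x :: real
proof -
  assume "x \<in> {-2<..<2}"
  then have "0 < (2 - x) * (2 + x)" by (intro mult_pos_pos) auto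
  then show ?thesis by (simp add: algebra_simps power2_eq_square)
qed

lemma has_real_derivative_sqrt_four_minus_square:
  assumes "x \<in> {-2<..<2}"
  shows "((\<lambda>x. sqrt (4 - x\<^sup>2)) has_real_derivative - x / sqrt (4 - x\<^sup>2)) (at x)"
  using four_minus_square_pos[OF assms]
  by (auto intro!: derivative_eq_intros simp: field_simps)

lemma semicircle_moment_0: "semicircle_moment 0 = 1"
proof -
  let ?F = "\<lambda>x. 1 / (2 * pi) * (x / 2 * sqrt (4 - x\<^sup>2) + 2 * arcsin (x / 2))"
  have "(LINT x:{-2..2}|lborel. x ^ 0 * semicircle_density x) = ?F 2 - ?F (-2)"
  proof (rule set_lborel_integral_FTC)
    show "continuous_on {-2..2} ?F"
      by (intro continuous_intros) auto
  next
    fix x :: real assume x: "x \<in> {-2<..<2}"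
    define s where "s = sqrt (4 - x\<^sup>2)"
    have s: "s > 0" "s * s = 4 - x\<^sup>2"
      using four_minus_square_pos[OF x] by (auto simp: s_def)
    have "sqrt (1 - (x / 2)\<^sup>2) = s / 2"
    proof -
      have "1 - (x / 2)\<^sup>2 = (4 - x\<^sup>2) / 2\<^sup>2"
        by (simp add: field_simps)
      then show ?thesis unfolding s_def by (simp only: real_sqrt_divide) simp
    qed
    then have "((\<lambda>x. arcsin (x / 2)) has_real_derivative 1 / s) (at x)"
      using x s by (auto intro!: derivative_eq_intros simp: divide_simps)
    then have "(?F has_real_derivative 1 / (2 * pi) * (1 / 2 * s + - x / s * (x / 2) + 2 * (1 / s))) (at x)"
      unfolding s_def
      by (intro DERIV_cmult DERIV_add DERIV_mult has_real_derivative_sqrt_four_minus_square[OF x])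
        (auto intro!: derivative_eq_intros)
    also have "1 / 2 * s + - x / s * (x / 2) + 2 * (1 / s) = s"
      using s by (simp add: field_simps power2_eq_square)
    finally show "(?F has_real_derivative x ^ 0 * semicircle_density x) (at x)"
      by (simp add: semicircle_density_def s_def)
  qed (auto intro!: continuous_intros)
  then show ?thesis
    by (simp add: semicircle_moment_def)
qed

lemma semicircle_moment_1: "semicircle_moment 1 = 0"
proof -
  let ?F = "\<lambda>x. 1 / (2 * pi) * (- 1 / 3 * ((4 - x\<^sup>2) * sqrt (4 - x\<^sup>2)))"
  have "(LINT x:{-2..2}|lborel. x ^ 1 * semicircle_density x) = ?F 2 - ?F (-2)"
  proof (rule set_lborel_integral_FTC)
    fix x :: real assume x: "x \<in> {-2<..<2}"
    define s where "s = sqrt (4 - x\<^sup>2)"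
    have s: "s > 0" "s * s = 4 - x\<^sup>2"
      using four_minus_square_pos[OF x] by (auto simp: s_def)
    have "(?F has_real_derivative 1 / (2 * pi) * (- 1 / 3 * (- (2 * x) * s + - x / s * (4 - x\<^sup>2)))) (at x)"
      unfolding s_def
      by (intro DERIV_cmult DERIV_mult has_real_derivative_sqrt_four_minus_square[OF x])
        (auto intro!: derivative_eq_intros)
    also have "- 1 / 3 * (- (2 * x) * s + - x / s * (4 - x\<^sup>2)) = x * s"
      using s by (simp add: s(2)[symmetric] field_simps)
    finally show "(?F has_real_derivative x ^ 1 * semicircle_density x) (at x)"
      by (simp add: semicircle_density_def s_def)
  qed (auto intro!: continuous_intros)
  then show ?thesis
    by (simp add: semicircle_moment_def)
qed

text \<open>Integration by parts: x^(r+1) (4 - x^2)^(3/2) vanishes at both endpoints, and its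
  derivative is 4 (r+1) x^r - (r+4) x^(r+2) times sqrt (4 - x^2). Here, as in the two lemmas above,
  differentiability is available only inside the interval, because the square root has no derivative
  at 2 and -2.\<close>

lemma semicircle_moment_rec:
  "real (r + 4) * semicircle_moment (r + 2) = 4 * real (r + 1) * semicircle_moment r"
proof -
  let ?F = "\<lambda>x. 1 / (2 * pi) * (x ^ (r + 1) * ((4 - x\<^sup>2) * sqrt (4 - x\<^sup>2)))"
  let ?f = "\<lambda>x. 4 * real (r + 1) * (x ^ r * semicircle_density x) -
    real (r + 4) * (x ^ (r + 2) * semicircle_density x)"
  have int: "set_integrable lborel {-2..2} (\<lambda>x. x ^ k * semicircle_density x)" for k
    by (intro borel_integrable_atLeastAtMost' continuous_intros)
  have "(LINT x:{-2..2}|lborel. ?f x) = ?F 2 - ?F (-2)"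
  proof (rule set_lborel_integral_FTC)
    fix x :: real assume x: "x \<in> {-2<..<2}"
    define s where "s = sqrt (4 - x\<^sup>2)"
    have s: "s > 0" "s * s = 4 - x\<^sup>2"
      using four_minus_square_pos[OF x] by (auto simp: s_def)
    have "(?F has_real_derivative 1 / (2 * pi) * (real (r + 1) * x ^ r * ((4 - x\<^sup>2) * s) +
       (- (2 * x) * s + - x / s * (4 - x\<^sup>2)) * x ^ (r + 1))) (at x)"
      unfolding s_def
      using DERIV_pow[of "r + 1" x]
      by (intro DERIV_cmult DERIV_mult has_real_derivative_sqrt_four_minus_square[OF x])
        (auto intro!: derivative_eq_intros)
    also have "- (2 * x) * s + - x / s * (4 - x\<^sup>2) = - 3 * x * s"
      using s by (simp add: s(2)[symmetric] field_simps)
    finally show "(?F has_real_derivative ?f x) (at x)"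
      by (simp add: semicircle_density_def s_def algebra_simps power2_eq_square add_divide_distrib
          diff_divide_distrib)
  qed (auto intro!: continuous_intros)
  also have "(LINT x:{-2..2}|lborel. ?f x) =
     4 * real (r + 1) * semicircle_moment r - real (r + 4) * semicircle_moment (r + 2)"
    unfolding semicircle_moment_def
    by (subst set_integral_diff(2), (rule set_integrable_mult_right, rule int)+) simp
  finally show ?thesis by simp
qed

text \<open>
  The generating function \<open>F\<close> of the moments makes \<open>G = 1 - 2 X\<^sup>2 F\<close> a solution of the linear
  equation \<open>(1 - 4 X\<^sup>2) G' = - 4 X G\<close>; so \<open>G\<^sup>2\<close> solves the same equation as \<open>1 - 4 X\<^sup>2\<close>.
\<close>

lemma semicircle_moment_convolution:
  "semicircle_moment (r + 2) = (\<Sum>j\<le>r. semicircle_moment j * semicircle_moment (r - j))"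
proof -
  define F where "F = Abs_fps semicircle_moment"
  define G where "G = 1 - 2 * fps_X ^ 2 * F"
  define H where "H = G ^ 2"
  have twoF: "fps_nth (2 * fps_X ^ 2 * F) n = (if n < 2 then 0 else 2 * semicircle_moment (n - 2))" for n
    by (simp add: mult.assoc fps_X_power_mult_nth F_def numeral_fps_const)
  have Gn: "fps_nth G n = (if n = 0 then 1 else if n < 2 then 0 else - 2 * semicircle_moment (n - 2))" for n
    unfolding G_def by (simp add: twoF)
  have lin: "fps_nth ((1 - 4 * fps_X ^ 2) * fps_deriv P) (Suc n) =
      real (n + 2) * fps_nth P (n + 2) - (if n = 0 then 0 else 4 * real n * fps_nth P n)" for P n
    by (cases n) (simp_all add: left_diff_distrib mult.assoc fps_X_power_mult_nth numeral_fps_const)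
  have lin0: "fps_nth ((1 - 4 * fps_X ^ 2) * fps_deriv P) 0 = fps_nth P 1" for P :: "real fps"
    by (simp add: left_diff_distrib mult.assoc fps_X_power_mult_nth numeral_fps_const)
  have G: "(1 - 4 * fps_X ^ 2) * fps_deriv G = - (4 * fps_X * G)"
  proof (rule fps_ext)
    fix n
    show "fps_nth ((1 - 4 * fps_X ^ 2) * fps_deriv G) n = fps_nth (- (4 * fps_X * G)) n"
    proof (cases n)
      case 0
      then show ?thesis by (simp add: lin0 Gn)
    next
      case (Suc k)
      have R: "fps_nth (- (4 * fps_X * G)) (Suc k) = - 4 * fps_nth G k"
        by (simp add: mult.assoc numeral_fps_const)
      consider "k = 0" | "k = 1" | j where "k = j + 2"
        using that(3)[of "k - 2"] that(1,2) by (cases "k < 2") (auto simp: less_2_cases_iff)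
      then show ?thesis
      proof cases
        case 1
        then show ?thesis unfolding Suc R lin by (simp add: Gn semicircle_moment_0)
      next
        case 2
        then show ?thesis unfolding Suc R lin
          using semicircle_moment_1 by (simp add: Gn)
      next
        case 3
        then show ?thesis unfolding Suc R lin
          using semicircle_moment_rec[of j] by (simp add: Gn algebra_simps)
      qed
    qed
  qed
  have "(1 - 4 * fps_X ^ 2) * fps_deriv H = 2 * G * ((1 - 4 * fps_X ^ 2) * fps_deriv G)"
    by (simp add: H_def power2_eq_square algebra_simps)
  also have "\<dots> = - (8 * fps_X * H)"
    unfolding G by (simp add: H_def power2_eq_square algebra_simps)
  finally have ODE: "(1 - 4 * fps_X ^ 2) * fps_deriv H = - (8 * fps_X * H)" .
  have H0: "fps_nth H 0 = 1"
    by (simp add: H_def power2_eq_square Gn)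
  have H1: "fps_nth H 1 = 0"
    using arg_cong[OF ODE, of "\<lambda>P. fps_nth P 0"] unfolding lin0 by simp
  \<comment> \<open>The factor 4 n - 8 vanishes at n = 2, so the even coefficients of
    \<open>H\<close> stop at degree 2; the odd ones are 0 because \<open>H1\<close> starts them at
    0.\<close>
  have step: "real (n + 2) * fps_nth H (n + 2) = (4 * real n - 8) * fps_nth H n" for n
    using arg_cong[OF ODE, of "\<lambda>P. fps_nth P (Suc n)"] unfolding lin
    by (auto simp: mult.assoc algebra_simps numeral_fps_const split: if_splits)
  have H2: "fps_nth H 2 = - 4"
    using step[of 0] H0 unfolding add_0 by simp
  have "fps_nth H (n + 3) = 0" for n
  proof (induction n rule: less_induct)
    case (less n)
    consider "n = 0" | "n = 1" | j where "n = j + 2"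
      using that(3)[of "n - 2"] that(1,2) by (cases "n < 2") (auto simp: less_2_cases_iff)
    then show ?case
    proof cases
      case 1
      then show ?thesis using step[of 1] H1 by (simp add: numeral_3_eq_3)
    next
      case 2
      then show ?thesis using step[of 2] by simp
    next
      case 3
      then show ?thesis using step[of "j + 3"] less[of j] by (simp add: add.commute)
    qed
  qed note H3 = this
  have "H = 1 - 4 * fps_X ^ 2"
  proof (rule fps_ext)
    fix n :: nat
    consider "n = 0" | "n = 1" | "n = 2" | j where "n = j + 3"
      using that(4)[of "n - 3"] that(1-3) by (cases "n < 3") (auto simp: less_Suc_eq numeral_3_eq_3)
    then show "fps_nth H n = fps_nth (1 - 4 * fps_X ^ 2) n"
      by cases (use H0 H1 H2 H3 in \<open>auto simp: fps_X_power_iff numeral_fps_const\<close>)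
  qed
  \<comment> \<open>Expanding G^2 = 1 - 4 X^2 and cancelling 4 X^2 leaves the quadratic equation F =
    1 + X^2 F^2, whose coefficients are the claimed convolution.\<close>
  then have "4 * fps_X ^ 2 * (fps_X ^ 2 * (F * F) + 1) = 4 * fps_X ^ 2 * F"
    unfolding H_def G_def by (simp add: algebra_simps power2_eq_square)
  then have "fps_X ^ 2 * (F * F) + 1 = F"
    by (subst (asm) mult_left_cancel) auto
  then have "fps_nth (fps_X ^ 2 * (F * F) + 1) (r + 2) = fps_nth F (r + 2)"
    by simp
  then have "fps_nth (F * F) r = fps_nth F (r + 2)"
    unfolding fps_add_nth fps_X_power_mult_nth by simp
  then show ?thesis
    by (simp add: F_def fps_mult_nth atLeast0AtMost)
qed

section \<open>Star-probability spaces\<close>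

context star_prob_space
begin

lemma phi_add: "phi (x + y) = phi x + phi y"
  and phi_scale: "phi (scaleC c x) = c * phi x"
  using phi_linear unfolding Vector_Spaces.linear_iff by auto

lemma phi_zero [simp]: "phi 0 = 0"
  using phi_scale[of 0 0] by simp

lemma phi_minus: "phi (- x) = - phi x"
  using phi_scale[of "-1" x] by (simp add: scale_minus_left)

lemma phi_diff: "phi (x - y) = phi x - phi y"
  using phi_add[of x "- y"] by (simp add: phi_minus)

lemma phi_sum: "phi (sum f A) = (\<Sum>x\<in>A. phi (f x))"
  by (induction A rule: infinite_finite_induct) (auto simp: phi_add)

lemma adj_one: "adj 1 = 1"
proof -
  have "adj (adj 1 * 1) = adj 1 * 1"
    by (simp only: adj_mult adj_adj)
  then show ?thesis by (simp add: adj_adj)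
qed

text \<open>Positivity at x and at 1 + x: in the expansion of (1 + x)^2 everything except 2
  \<open>phi x\<close> is already known to be real.\<close>

lemma phi_self_adjoint_real:
  assumes "adj x = x"
  shows "Im (phi x) = 0"
proof -
  have "phi (adj x * x) \<in> \<real>\<^sub>\<ge>\<^sub>0" "phi (adj (1 + x)
      * (1 + x)) \<in> \<real>\<^sub>\<ge>\<^sub>0"
    by (rule phi_positive)+
  then show ?thesis
    using assms by (auto simp: adj_add adj_one phi_add phi_one algebra_simps complex_nonneg_Reals_iff)
qed

lemma phi_square_real:
  assumes "adj x = x"
  shows "Im (phi (x * x)) = 0" "Re (phi (x * x)) \<ge> 0"
  using phi_positive[of x] assms by (auto simp: complex_nonneg_Reals_iff)

text \<open>The degenerate case of Cauchy-Schwarz. Since \<open>phi (x * x) = 0\<close>, the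
  nonnegative value of \<open>phi\<close> at adj (z + c x) times (z + c x) has no quadratic term in
  c; a real-affine function bounded below is constant, and testing real and imaginary c kills both
  coefficients.\<close>

lemma phi_null_left:
  assumes "adj x = x" "phi (x * x) = 0"
  shows "phi (x * z) = 0"
proof -
  define A where "A = phi (adj z * x)"
  define B where "B = phi (x * z)"
  define D where "D = phi (adj z * z)"
  have "D + c * A + cnj c * B \<in> \<real>\<^sub>\<ge>\<^sub>0" for c
  proof -
    have "phi (adj (z + scaleC c x) * (z + scaleC c x)) =
       D + c * A + cnj c * B + cnj c * c * phi (x * x)"
      by (simp add: A_def B_def D_def adj_add adj_scaleC assms distrib_left distrib_right
          scaleC_mult_left scaleC_mult_right phi_add phi_scale)
    then show ?thesis
      using phi_positive[of "z + scaleC c x"] assms by simp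
  qed
  then have *: "Re (D + c * A + cnj c * B) \<ge> 0 \<and> Im (D + c * A + cnj c * B) = 0" for c
    by (auto simp: complex_nonneg_Reals_iff)
  have D: "Im D = 0" using *[of 0] by simp
  have 1: "Im (A + B) = 0" using *[of 1] D by simp
  have 2: "Re A = Re B" using *[of \<i>] D by simp
  have "Re D + t * Re (A + B) \<ge> 0" for t :: real
    using *[of "of_real t"] by (simp add: algebra_simps)
  \<comment> \<open>If the slope were not 0, this t would make the affine function at most
    -1.\<close>
  from this[of "- (\<bar>Re D\<bar> + 1) / Re (A + B)"] have 3: "Re (A + B) = 0"
    by (cases "Re (A + B) = 0") auto
  have "Re D + t * Im (B - A) \<ge> 0" for t :: real
    using *[of "of_real t * \<i>"] by (simp add: algebra_simps)
  from this[of "- (\<bar>Re D\<bar> + 1) / Im (B - A)"] have 4: "Im (B - A) = 0"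
    by (cases "Im (B - A) = 0") auto
  show ?thesis
    using 1 2 3 4 by (intro complex_eqI) (auto simp: B_def)
qed

lemma scalar_binomial:
  "(scaleC b x + scaleC c 1) ^ m =
     (\<Sum>r\<le>m. scaleC (of_nat (m choose r) * b ^ r * c ^ (m - r)) (x ^ r))"
proof (induction m)
  case (Suc m)
  let ?t = "\<lambda>m r. scaleC (of_nat (m choose r) * b ^ r * c ^ (m - r)) (x ^ r)"
  have "(scaleC b x + scaleC c 1) ^ Suc m =
     (\<Sum>r\<le>m. scaleC (of_nat (m choose r) * b ^ Suc r * c ^ (m - r)) (x ^ Suc r)) +
     (\<Sum>r\<le>m. scaleC (of_nat (m choose r) * b ^ r * c ^ Suc (m - r)) (x ^ r))"
    by (simp add: Suc.IH distrib_right sum_distrib_left scaleC_mult_left scaleC_mult_right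
        scale_right_distrib sum.distrib mult_ac)
  also have "(\<Sum>r\<le>m. scaleC (of_nat (m choose r) * b ^ r * c ^ Suc (m - r)) (x ^ r)) =
     (\<Sum>r\<le>Suc m. scaleC (of_nat (m choose r) * b ^ r * c ^ (Suc m - r)) (x ^ r))"
    by (simp add: Suc_diff_le)
  also have "\<dots> = scaleC (c ^ Suc m) 1 +
     (\<Sum>r\<le>m. scaleC (of_nat (m choose Suc r) * b ^ Suc r * c ^ (m - r)) (x ^ Suc r))"
    by (subst sum.atMost_Suc_shift) simp
  finally show ?case
    by (subst sum.atMost_Suc_shift) (simp add: sum.distrib[symmetric] scale_left_distrib algebra_simps)
qed simp

end

section \<open>Moments of words in free semicircular variables\<close>

text \<open>
  For \<open>t = \<theta>\<^sup>2\<close> these are the joint moments of free semicircular variables of variance \<open>t\<close>: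
  the first letter is paired with a later occurrence of itself, and no pair crosses this one.
\<close>

fun semicircle_word :: "real \<Rightarrow> nat list \<Rightarrow> real" where
  "semicircle_word t [] = 1"
| "semicircle_word t (i # w) =
     t * (\<Sum>j<length w. if w ! j = i
       then semicircle_word t (take j w) * semicircle_word t (drop (Suc j) w) else 0)"

text \<open>The partner of the first letter is never its neighbour, so the enclosed subword is
  nonempty and again has no equal neighbours. By induction the first factor of every summand
  vanishes.\<close>

lemma semicircle_word_distinct_adj:
  "distinct_adj w \<Longrightarrow> w \<noteq> [] \<Longrightarrow> semicircle_word t w = 0"
proof (induction w rule: length_induct)
  case (1 w)
  then obtain i v where w: "w = i # v" by (cases w) auto
  have "semicircle_word t (take j v) = 0" if "j < length v" "v ! j = i" for j
  proof -
    have "j \<noteq> 0"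
    proof
      assume "j = 0"
      then have "v \<noteq> []" "hd v = i" using that by (auto simp: hd_conv_nth)
      then show False using 1(2) unfolding w by (simp add: distinct_adj_Cons)
    qed
    moreover have "distinct_adj (take j v)"
      using 1(2) unfolding w by (metis append_take_drop_id distinct_adj_ConsD distinct_adj_appendD1)
    ultimately show ?thesis
      using that 1(1)[rule_format, of "take j v"] unfolding w by (cases "v = []") auto
  qed
  then show ?case by (auto simp: w intro!: sum.neutral)
qed

text \<open>Cutting out a pair of equal letters cannot use up the single i, which therefore survives
  as a single letter in one of the two subwords.\<close>

lemma semicircle_word_singleton:
  "count_list w i = 1 \<Longrightarrow> semicircle_word t w = 0"
proof (induction w rule: length_induct)
  case (1 w)
  show ?case
  proof (cases w)
    case (Cons k v)
    have "semicircle_word t (take j v) * semicircle_word t (drop (Suc j) v) = 0"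
      if j: "j < length v" "v ! j = k" for j
    proof -
      have v: "v = take j v @ k # drop (Suc j) v"
        using id_take_nth_drop[OF j(1)] j(2) by simp
      have c: "count_list v i =
         count_list (take j v) i + (if k = i then 1 else 0) + count_list (drop (Suc j) v) i"
        by (subst v) (simp add: count_list_append)
      have "count_list v i + (if k = i then 1 else 0) = 1"
        using 1(2) unfolding Cons by (simp split: if_splits)
      then have "count_list (take j v) i = 1 \<or> count_list (drop (Suc j) v) i = 1"
        using c by (auto split: if_splits)
      then show ?thesis
        using 1(1) unfolding Cons by auto
    qed
    then show ?thesis by (auto simp: Cons intro!: sum.neutral)
  qed (use 1 in auto)
qed

lemma sum_lessThan_add:
  fixes f :: "nat \<Rightarrow> 'a::comm_monoid_add"
  shows "(\<Sum>j<a + b. f j) = (\<Sum>j<a. f j) + (\<Sum>j<b. f (a + j))"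
  by (induction b) (auto simp: add.assoc)

text \<open>The combinatorial counterpart of \<open>phi_word_remove_pair\<close>. If u is empty, the
  first i has only the second as a partner. Otherwise the first letter of u differs from i, so its
  partner lies in u or in v, and the adjacent pair stays together in one of the two subwords;
  partners in v are merely shifted by 2.\<close>

lemma semicircle_word_remove_pair:
  assumes "i \<notin> set u" "i \<notin> set v"
  shows "semicircle_word t (u @ i # i # v) = t * semicircle_word t (u @ v)"
  using assms
proof (induction "length u + length v" arbitrary: u v rule: less_induct)
  case less
  show ?case
  proof (cases u)
    case Nil
    have "(\<Sum>j<length v. if v ! j = i then semicircle_word t (i # take j v) *
             semicircle_word t (drop j v) else 0) = 0"
      using less.prems by (intro sum.neutral) (auto simp: in_set_conv_nth)
    then show ?thesis
      using less.prems
      by (auto simp: Nil sum.lessThan_Suc_shift in_set_conv_nth semicircle_word.simps(2)[of _ _ "_ # _"]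
          simp del: sum.lessThan_Suc semicircle_word.simps(2) intro!: sum.neutral)
  next
    case (Cons k u')
    let ?g = "\<lambda>w j. if w ! j = k then semicircle_word t (take j w)
        * semicircle_word t (drop (Suc j) w) else 0"
    have k: "k \<noteq> i" "i \<notin> set u'" using less.prems Cons by auto
    have A: "?g (u' @ i # i # v) j = t * ?g (u' @ v) j" if "j < length u'" for j
    proof -
      have "semicircle_word t (drop (Suc j) u' @ i # i # v) = t * semicircle_word t (drop (Suc j) u' @ v)"
        using that less.prems k by (intro less.hyps) (auto simp: Cons dest: in_set_dropD)
      then show ?thesis using that by (simp add: nth_append)
    qed
    have B: "?g (u' @ i # i # v) (length u' + 2 + j) = t * ?g (u' @ v) (length u' + j)" if "j < length v" for j
    proof -
      have "semicircle_word t (u' @ i # i # take j v) = t * semicircle_word t (u' @ take j v)"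
        using that less.prems k by (intro less.hyps) (auto simp: Cons dest: in_set_takeD)
      then show ?thesis by (simp add: nth_append numeral_3_eq_3 numeral_2_eq_2)
    qed
    have "semicircle_word t (u @ i # i # v) = t * (\<Sum>j<length u' + (2 + length v). ?g (u' @ i # i # v) j)"
      by (simp add: Cons)
    also have "\<dots> = t * ((\<Sum>j<length u'. ?g (u' @ i # i # v) j) +
        (\<Sum>j<2. ?g (u' @ i # i # v) (length u' + j)) +
        (\<Sum>j<length v. ?g (u' @ i # i # v) (length u' + 2 + j)))"
      by (simp only: sum_lessThan_add add.assoc)
    also have "(\<Sum>j<2. ?g (u' @ i # i # v) (length u' + j)) = 0"
      using k by (auto simp: numeral_2_eq_2 nth_append)
    also have "(\<Sum>j<length u'. ?g (u' @ i # i # v) j) = (\<Sum>j<length u'. t * ?g (u' @ v) j)"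
      by (rule sum.cong) (use A in auto)
    also have "(\<Sum>j<length v. ?g (u' @ i # i # v) (length u' + 2 + j)) =
        (\<Sum>j<length v. t * ?g (u' @ v) (length u' + j))"
      by (rule sum.cong) (use B in auto)
    also have "t * ((\<Sum>j<length u'. t * ?g (u' @ v) j) + 0 + (\<Sum>j<length v. t
        * ?g (u' @ v) (length u' + j))) =
        t * (t * (\<Sum>j<length u' + length v. ?g (u' @ v) j))"
      by (simp only: sum_lessThan_add sum_distrib_left distrib_left add_0_right)
    also have "\<dots> = t * semicircle_word t (u @ v)"
      by (simp add: Cons)
    finally show ?thesis .
  qed
qed

text \<open>A crude estimate; what matters is that it depends on the length of the word only and is
  thus uniform in the number k of available letters.\<close>

lemma semicircle_word_bound: "\<bar>semicircle_word t w\<bar>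
    \<le> (1 + \<bar>t\<bar>) ^ length w * fact (length w)"
proof (induction w rule: length_induct)
  case (1 w)
  show ?case
  proof (cases w)
    case (Cons i v)
    define T where "T = 1 + \<bar>t\<bar>"
    have T: "1 \<le> T" "\<bar>t\<bar> \<le> T" by (auto simp: T_def)
    \<comment> \<open>Bounds each summand, since j! (n - 1 - j)! <= (n - 1)! for n =
      \<open>length v\<close>; adding n such terms restores n!.\<close>
    define B where "B = T ^ length v * fact (length v - 1)"
    have B: "\<bar>semicircle_word t (take j v) * semicircle_word t (drop (Suc j) v)\<bar> \<le> B"
      if j: "j < length v" for j
    proof -
      have "\<bar>semicircle_word t (take j v) * semicircle_word t (drop (Suc j) v)\<bar> \<le>
         (T ^ j * fact j) * (T ^ (length v - Suc j) * fact (length v - Suc j))"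
        unfolding abs_mult
      proof (rule mult_mono)
        show "\<bar>semicircle_word t (take j v)\<bar> \<le> T ^ j * fact j"
          using 1[rule_format, of "take j v"] j by (auto simp: Cons T_def min_def)
        show "\<bar>semicircle_word t (drop (Suc j) v)\<bar>
            \<le> T ^ (length v - Suc j) * fact (length v - Suc j)"
          using 1[rule_format, of "drop (Suc j) v"] j by (auto simp: Cons T_def)
      qed (use T in auto)
      also have "\<dots> = T ^ (length v - 1) * (fact j * fact (length v - Suc j))"
        using j by (simp add: power_add[symmetric] algebra_simps)
      also have "\<dots> \<le> T ^ length v * fact (length v - 1)"
      proof (rule mult_mono)
        have "fact j * fact (length v - Suc j) \<le> (fact (j + (length v - Suc j)) :: nat)"
          by (intro dvd_imp_le fact_fact_dvd_fact) auto
        then have "real (fact j * fact (length v - Suc j)) \<le> real (fact (length v - 1))"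
          using j by (intro of_nat_mono) auto
        then show "fact j * fact (length v - Suc j) \<le> (fact (length v - 1) :: real)"
          by simp
      qed (use T in \<open>auto intro!: power_increasing\<close>)
      finally show ?thesis by (simp add: B_def)
    qed
    have "\<bar>semicircle_word t w\<bar> \<le> \<bar>t\<bar> * (\<Sum>j<length v. B)"
      unfolding Cons semicircle_word.simps abs_mult
    proof (intro mult_left_mono order_trans[OF sum_abs] sum_mono)
      fix j assume "j \<in> {..<length v}"
      then have "\<bar>semicircle_word t (take j v) * semicircle_word t (drop (Suc j) v)\<bar> \<le> B"
        by (intro B) auto
      then show "\<bar>if v ! j = i then semicircle_word t (take j v)
          * semicircle_word t (drop (Suc j) v) else 0\<bar> \<le> B"
        by (auto intro: order_trans[OF abs_ge_zero])
    qed auto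
    also have "\<dots> = \<bar>t\<bar> * T ^ length v * (real (length v) * fact (length v - 1))"
      by (simp add: B_def)
    also have "\<dots> \<le> T * T ^ length v * fact (Suc (length v))"
    proof (intro mult_mono)
      have "real (length v) * fact (length v - 1) \<le> fact (length v)"
        by (cases "length v") (auto simp: algebra_simps)
      also have "\<dots> \<le> fact (Suc (length v))" by (rule fact_mono) auto
      finally show "real (length v) * fact (length v - 1) \<le> fact (Suc (length v))" .
    qed (use T in auto)
    finally show ?thesis by (simp add: Cons T_def)
  qed auto
qed

section \<open>Sums over all words in k letters\<close>

definition words :: "nat \<Rightarrow> nat \<Rightarrow> nat list set" where
  "words k n = {w. set w \<subseteq> {1..k} \<and> length w = n}"

lemma finite_words [simp]: "finite (words k n)"
  unfolding words_def by (rule finite_lists_length_eq) auto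

lemma card_words: "card (words k n) = k ^ n"
  unfolding words_def by (subst card_lists_length_eq) auto

lemma words_0 [simp]: "words k 0 = {[]}"
  by (auto simp: words_def)

lemma sum_words_Suc: "(\<Sum>w\<in>words k (Suc n). f w) = (\<Sum>i=1..k. \<Sum>w\<in>words k n. f (i # w))"
proof -
  have "words k (Suc n) = (\<lambda>(i, w). i # w) ` ({1..k} \<times> words k n)"
    by (auto simp: words_def length_Suc_conv image_iff)
  then have "(\<Sum>w\<in>words k (Suc n). f w) = (\<Sum>(i, w)\<in>{1..k} \<times> words k n. f (i # w))"
    by (simp add: sum.reindex inj_on_def case_prod_unfold)
  then show ?thesis by (simp add: sum.cartesian_product)
qed

lemma sum_words_add:
  "(\<Sum>w\<in>words k (m + n). f (take m w) (drop m w)) = (\<Sum>u\<in>words k m. \<Sum>v\<in>words k n. f u v)"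
proof (induction m arbitrary: f)
  case (Suc m)
  have "(\<Sum>w\<in>words k (Suc m + n). f (take (Suc m) w) (drop (Suc m) w)) =
     (\<Sum>i=1..k. \<Sum>w\<in>words k (m + n). f (i # take m w) (drop m w))"
    by (simp add: sum_words_Suc)
  also have "\<dots> = (\<Sum>i=1..k. \<Sum>u\<in>words k m. \<Sum>v\<in>words k n. f (i # u) v)"
    by (rule sum.cong[OF refl]) (rule Suc.IH)
  finally show ?case by (simp add: sum_words_Suc)
qed simp

lemma power_sum_words:
  fixes X :: "nat \<Rightarrow> 'a::ring_1"
  shows "(\<Sum>i=1..k. X i) ^ n = (\<Sum>w\<in>words k n. prod_list (map X w))"
  by (induction n) (simp_all add: sum_words_Suc sum_product)

text \<open>Summing over the first letter uses up the condition that it equals the letter at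
  position j. That letter is then unconstrained and gives the factor k, while the subwords on its
  two sides range independently.\<close>

lemma sum_semicircle_word_Suc:
  "(\<Sum>w\<in>words k (Suc n). semicircle_word t w) =
     t * real k * (\<Sum>j<n. (\<Sum>u\<in>words k j. semicircle_word t u) * (\<Sum>v\<in>words k (n
         - Suc j). semicircle_word t v))"
proof -
  have "(\<Sum>w\<in>words k (Suc n). semicircle_word t w) =
    (\<Sum>i=1..k. \<Sum>w\<in>words k n. t * (\<Sum>j<n. if w ! j = i
       then semicircle_word t (take j w) * semicircle_word t (drop (Suc j) w) else 0))"
    unfolding sum_words_Suc by (intro sum.cong refl) (simp add: words_def)
  also have "\<dots> = t * (\<Sum>i=1..k. \<Sum>w\<in>words k n. \<Sum>j<n. if w ! j = i
       then semicircle_word t (take j w) * semicircle_word t (drop (Suc j) w) else 0)"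
    by (simp only: sum_distrib_left)
  also have "\<dots> = t * (\<Sum>w\<in>words k n. \<Sum>j<n. \<Sum>i=1..k. if w ! j = i
       then semicircle_word t (take j w) * semicircle_word t (drop (Suc j) w) else 0)"
    by (subst sum.swap, rule arg_cong[where f = "(*) t"], rule sum.cong[OF refl], rule sum.swap)
  also have "\<dots> = t * (\<Sum>j<n. \<Sum>w\<in>words k n. \<Sum>i=1..k. if w ! j = i
       then semicircle_word t (take j w) * semicircle_word t (drop (Suc j) w) else 0)"
    by (rule arg_cong[where f = "(*) t"], rule sum.swap)
  also have "\<dots> = t * (\<Sum>j<n. real k * ((\<Sum>u\<in>words k j. semicircle_word t u)
      * (\<Sum>v\<in>words k (n - Suc j). semicircle_word t v)))"
  proof (intro arg_cong[where f = "(*) t"] sum.cong refl)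
    fix j assume "j \<in> {..<n}"
    then have j: "j < n" "n = j + Suc (n - Suc j)" by auto
    have "(\<Sum>w\<in>words k n. \<Sum>i=1..k. if w ! j = i
       then semicircle_word t (take j w) * semicircle_word t (drop (Suc j) w) else 0) =
       (\<Sum>w\<in>words k n. semicircle_word t (take j w) * semicircle_word t (drop (Suc j) w))"
    proof (rule sum.cong[OF refl])
      fix w assume w: "w \<in> words k n"
      then have "w ! j \<in> set w" using j by (auto simp: words_def)
      then have "w ! j \<in> {1..k}" using w by (auto simp: words_def)
      then show "(\<Sum>i=1..k. if w ! j = i
       then semicircle_word t (take j w) * semicircle_word t (drop (Suc j) w) else 0) =
        semicircle_word t (take j w) * semicircle_word t (drop (Suc j) w)"
        by (subst sum.delta') auto
    qed
    \<comment> \<open>The letter at position j becomes the head of a second block of length n - j,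
      so that the word can be split there; \<open>tl\<close> drops it from the summand.\<close>
    also have "\<dots> = (\<Sum>w\<in>words k (j + Suc (n
        - Suc j)). semicircle_word t (take j w) * semicircle_word t (tl (drop j w)))"
      using j by (simp add: drop_Suc tl_drop)
    also have "\<dots> = (\<Sum>u\<in>words k j. \<Sum>v\<in>words k (Suc (n
        - Suc j)). semicircle_word t u * semicircle_word t (tl v))"
      by (rule sum_words_add)
    also have "\<dots> = real k * (\<Sum>u\<in>words k j. \<Sum>v\<in>words k (n
        - Suc j). semicircle_word t u * semicircle_word t v)"
      unfolding sum_distrib_left by (simp add: sum_words_Suc sum_distrib_left)
    also have "\<dots> = real k * ((\<Sum>u\<in>words k j. semicircle_word t u)
        * (\<Sum>v\<in>words k (n - Suc j). semicircle_word t v))"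
      by (simp only: sum_product)
    finally show "(\<Sum>w\<in>words k n. \<Sum>i=1..k. if w ! j = i
       then semicircle_word t (take j w) * semicircle_word t (drop (Suc j) w) else 0) =
       real k * ((\<Sum>u\<in>words k j. semicircle_word t u) * (\<Sum>v\<in>words k (n
           - Suc j). semicircle_word t v))" .
  qed
  finally show ?thesis by (simp add: sum_distrib_left mult.assoc)
qed

text \<open>Both sides obey the same recursion: \<open>sum_semicircle_word_Suc\<close> splits words
  as \<open>semicircle_moment_convolution\<close> splits moments, and the removed pair contributes t
  k, the square of the scale q.\<close>

lemma sum_semicircle_word:
  assumes "t \<ge> 0"
  shows "(\<Sum>w\<in>words k n. semicircle_word t w) = semicircle_moment n * sqrt (t * real k) ^ n"
proof (induction n rule: less_induct)
  case (less n)
  define q where "q = sqrt (t * real k)"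
  have q: "t * real k = q ^ 2" using assms by (simp add: q_def)
  consider "n = 0" | "n = 1" | r where "n = Suc (Suc r)"
    by (metis One_nat_def old.nat.exhaust)
  then show ?case
  proof cases
    case 1
    then show ?thesis by (simp add: semicircle_moment_0)
  next
    case 2
    then show ?thesis using semicircle_moment_1 sum_semicircle_word_Suc[of t k 0] by simp
  next
    case 3
    have "(\<Sum>w\<in>words k n. semicircle_word t w)
        = q ^ 2 * (\<Sum>j\<le>r. (semicircle_moment j * q ^ j) * (semicircle_moment (r - j) * q ^ (r - j)))"
      unfolding 3 sum_semicircle_word_Suc q lessThan_Suc_atMost
      using less by (intro arg_cong[where f = "(*) (q ^ 2)"] sum.cong refl) (auto simp: 3 q_def)
    also have "\<dots> = q ^ 2 * (\<Sum>j\<le>r. semicircle_moment j * semicircle_moment (r - j) * q ^ r)"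
    proof (intro arg_cong[where f = "(*) (q ^ 2)"] sum.cong refl)
      fix j assume "j \<in> {..r}"
      then have "q ^ r = q ^ j * q ^ (r - j)" by (simp flip: power_add)
      then show "(semicircle_moment j * q ^ j) * (semicircle_moment (r - j) * q ^ (r - j)) =
          semicircle_moment j * semicircle_moment (r - j) * q ^ r" by simp
    qed
    also have "\<dots> = semicircle_moment (r + 2) * q ^ (r + 2)"
      unfolding semicircle_moment_convolution by (simp add: sum_distrib_right sum_distrib_left
          power2_eq_square mult_ac)
    finally show ?thesis by (simp add: 3 q_def)
  qed
qed

text \<open>Such a word is determined by a list of d letters, repetitions allowed, and a pattern of
  n positions in that list; there are k^d lists and d^n patterns.\<close>

lemma card_words_few_letters:
  assumes "n \<noteq> 0"
  shows "card {w \<in> words k n. card (set w) \<le> d} \<le> d ^ n * k ^ d"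
proof -
  have "{w \<in> words k n. card (set w) \<le> d} \<subseteq>
     (\<lambda>(l, p). map ((!) l) p) ` (words k d \<times> {p. set p \<subseteq> {..<d} \<and> length p = n})"
  proof
    fix w assume "w \<in> {w \<in> words k n. card (set w) \<le> d}"
    then have w: "set w \<subseteq> {1..k}" "length w = n" "card (set w) \<le> d" by (auto simp: words_def)
    \<comment> \<open>Padding with a letter of w keeps the list inside 1..k; \<open>hd w\<close> is
      available because n is not 0.\<close>
    define l where "l = sorted_list_of_set (set w) @ replicate (d - card (set w)) (hd w)"
    have l: "set w \<subseteq> set l" "l \<in> words k d"
      using w assms hd_in_set[of w] by (auto simp: l_def words_def)
    have "\<exists>j. j < d \<and> l ! j = x" if "x \<in> set w" for x
      using l that by (auto simp: words_def in_set_conv_nth subset_iff)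
    then obtain f where f: "\<And>x. x \<in> set w \<Longrightarrow> f x < d \<and> l ! f x = x" by metis
    have "w = (\<lambda>(l, p). map ((!) l) p) (l, map f w)"
      using f by (auto intro!: nth_equalityI)
    then show "w \<in> (\<lambda>(l, p). map ((!) l) p) `
        (words k d \<times> {p. set p \<subseteq> {..<d} \<and> length p = n})"
      using l f w by (intro image_eqI[where x = "(l, map f w)"]) auto
  qed
  then have "card {w \<in> words k n. card (set w) \<le> d} \<le>
      card (words k d \<times> {p. set p \<subseteq> {..<d} \<and> length p = n})"
    by (intro surj_card_le finite_cartesian_product finite_words finite_lists_length_eq) auto
  also have "\<dots> = d ^ n * k ^ d"
    by (simp add: card_cartesian_product card_words card_lists_length_eq)
  finally show ?thesis .
qed

section \<open>Words in centred free variables\<close>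

locale free_iid_family = star_prob_space scaleC adj phi
  for scaleC :: "complex \<Rightarrow> 'a::ring_1 \<Rightarrow> 'a" and adj ::
      "'a \<Rightarrow> 'a" and phi :: "'a \<Rightarrow> complex" +
  fixes a :: "nat \<Rightarrow> 'a"
  assumes self_adjoint: "i \<ge> 1 \<Longrightarrow> adj (a i) = a i"
    and free: "free_variables scaleC adj phi {1..} a"
    and identically_distributed: "i \<ge> 1 \<Longrightarrow> phi (a i ^ m) = phi (a 1 ^ m)"
begin

definition X :: "nat \<Rightarrow> 'a" where
  "X i = a i - scaleC (phi (a 1)) 1"

definition mom :: "nat \<Rightarrow> complex" where
  "mom e = phi (X 1 ^ e)"

text \<open>The argument pairs an index with an exponent, so that an alternating product of centred
  powers is coded by a list of pairs. Exponent 1 gives back X i, because the first moment is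
  0.\<close>

definition cent :: "nat \<times> nat \<Rightarrow> 'a" where
  "cent p = X (fst p) ^ snd p - scaleC (mom (snd p)) 1"

abbreviation word :: "nat list \<Rightarrow> 'a" where
  "word w \<equiv> prod_list (map X w)"

lemma phi_scale_one: "phi (scaleC c 1) = c"
  by (simp add: phi_scale phi_one)

lemma X_alt: "X i = scaleC 1 (a i) + scaleC (- phi (a 1)) 1"
  by (simp add: X_def scale_minus_left)

lemma phi_X_power: "i \<ge> 1 \<Longrightarrow> phi (X i ^ e) = mom e"
  unfolding mom_def X_alt scalar_binomial
  by (simp add: phi_sum phi_scale identically_distributed[of i])

lemma mom_0: "mom 0 = 1" and mom_1: "mom 1 = 0"
  by (simp_all add: mom_def phi_one X_def phi_diff phi_scale)

lemma mom_one: "mom (Suc 0) = 0"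
  using mom_1 by simp

lemma Im_phi_a: "Im (phi (a 1)) = 0"
  by (simp add: phi_self_adjoint_real self_adjoint)

lemma phi_a_real: "phi (a 1) = of_real (rs_alpha phi a)"
  using Im_phi_a by (simp add: rs_alpha_def complex_eq_iff)

lemma adj_X: "i \<ge> 1 \<Longrightarrow> adj (X i) = X i"
  unfolding X_alt phi_a_real by (simp add: adj_add adj_scaleC self_adjoint adj_one del: scale_minus_left)

text \<open>The radicand in \<open>rs_theta\<close> equals \<open>phi (X 1 * X 1)\<close>, which is
  nonnegative by positivity; hence squaring undoes the root.\<close>

lemma mom_2: "mom 2 = of_real ((rs_theta phi a)\<^sup>2)" and rs_theta_nonneg: "rs_theta phi a \<ge> 0"
proof -
  have "mom 2 = phi (X 1 * X 1)"
    by (simp add: mom_def power2_eq_square)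
  moreover have "X 1 * X 1 = (a 1)\<^sup>2 - scaleC (2 * phi (a 1)) (a 1) + scaleC ((phi (a 1))\<^sup>2) 1"
  proof -
    have "scaleC (2 * phi (a 1)) (a 1) = scaleC (phi (a 1)) (a 1) + scaleC (phi (a 1)) (a 1)"
      by (simp flip: scale_left_distrib)
    then show ?thesis
      by (simp add: X_def algebra_simps scaleC_mult_left scaleC_mult_right power2_eq_square)
  qed
  ultimately have m: "mom 2 = phi ((a 1)\<^sup>2) - (phi (a 1))\<^sup>2"
    by (simp add: phi_add phi_diff phi_scale phi_one power2_eq_square)
  have pos: "Im (mom 2) = 0" "Re (mom 2) \<ge> 0"
    using phi_square_real[of "X 1"] by (simp_all add: adj_X mom_def power2_eq_square)
  have "Re (mom 2) = Re (phi ((a 1)\<^sup>2)) - (rs_alpha phi a)\<^sup>2"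
    unfolding m phi_a_real by simp
  then have "Re (mom 2) = (rs_theta phi a)\<^sup>2"
    using pos by (simp add: rs_theta_def)
  then show "mom 2 = of_real ((rs_theta phi a)\<^sup>2)" using pos by (simp add: complex_eq_iff)
  show "rs_theta phi a \<ge> 0"
    using pos \<open>Re (mom 2) = Re (phi ((a 1)\<^sup>2)) - _\<close> by (simp add: rs_theta_def)
qed

lemma phi_cent: "fst p \<ge> 1 \<Longrightarrow> phi (cent p) = 0"
  by (simp add: cent_def phi_diff phi_X_power phi_scale_one)

lemma cent_mem: "cent p \<in> generated_star_subalgebra scaleC adj {a (fst p)}"
  unfolding generated_star_subalgebra_def
proof safe
  fix B assume B: "unital_star_subalgebra scaleC adj B" and a: "{a (fst p)} \<subseteq> B"
  have [simp]: "1 \<in> B" and add: "\<And>x y. x \<in> B \<Longrightarrow> y \<in> B \<Longrightarrow>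
      x + y \<in> B"
    and mult: "\<And>x y. x \<in> B \<Longrightarrow> y \<in> B \<Longrightarrow> x
        * y \<in> B" and scl: "\<And>c x. x \<in> B \<Longrightarrow> scaleC c x \<in> B"
    using B unfolding unital_star_subalgebra_def by auto
  have X: "X (fst p) \<in> B"
    unfolding X_alt using a by (intro add scl) auto
  have "X (fst p) ^ e \<in> B" for e
    by (induction e) (auto intro: mult X)
  then have "X (fst p) ^ snd p + scaleC (- mom (snd p)) 1 \<in> B"
    by (intro add scl) auto
  then show "cent p \<in> B"
    by (simp add: cent_def scale_minus_left)
qed

lemma phi_reduced:
  assumes "ws \<noteq> []" "distinct_adj (map fst ws)" "fst ` set ws \<subseteq> {1..}"
  shows "phi (prod_list (map cent ws)) = 0"
proof -
  have "\<forall>k<length (map fst ws). map cent ws ! k \<in>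
      generated_star_subalgebra scaleC adj {a (map fst ws ! k)} \<and> phi (map cent ws ! k) = 0"
    using assms(3) by (auto simp: cent_mem image_subset_iff intro!: phi_cent)
  then show ?thesis
    using assms free[unfolded free_variables_def free_subalgebras_def, rule_format, of "map fst ws" "map cent ws"]
    by auto
qed

text \<open>
  \<open>x\<close> is a combination of reduced words over the indices \<open>J\<close> in the centred powers of degree at
  most \<open>d\<close>, with coefficients of total modulus at most \<open>K\<close>.
\<close>

inductive reduced_rep :: "nat set \<Rightarrow> nat \<Rightarrow> real \<Rightarrow> 'a \<Rightarrow>
    bool" for J where
  word: "distinct_adj (map fst ws) \<Longrightarrow> fst ` set ws \<subseteq> J \<Longrightarrow>
      \<forall>p\<in>set ws. snd p \<le> d \<Longrightarrow> 1 \<le> K \<Longrightarrow>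
    reduced_rep J d K (prod_list (map cent ws))"
| scale: "reduced_rep J d K x \<Longrightarrow> cmod c * K
    \<le> L \<Longrightarrow> reduced_rep J d L (scaleC c x)"
| add: "reduced_rep J d K x \<Longrightarrow> reduced_rep J d L y \<Longrightarrow> reduced_rep J d
    (K + L) (x + y)"

lemma reduced_rep_mono: "reduced_rep J d K x \<Longrightarrow> K \<le> L \<Longrightarrow> reduced_rep J d L x"
  using reduced_rep.scale[of J d K x 1 L] by simp

text \<open>If the reduced word does not begin with index i, then X i simply becomes a new first
  letter. If it begins with \<open>cent (i, e)\<close>, the merged power has to be recentred, which
  produces three reduced words with coefficients 1, \<open>mom (Suc e)\<close> and -
  \<open>mom e\<close>; this is the source of 1 + 2 C. The cap D lets one C serve a whole induction
  on the length.\<close>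

lemma reduced_rep_mult_X:
  assumes "reduced_rep J d K x" "i \<in> J" "Suc d \<le> D" "\<And>e. e
      \<le> D \<Longrightarrow> cmod (mom e) \<le> C"
  shows "reduced_rep J (Suc d) ((1 + 2 * C) * K) (X i * x)"
  using assms
proof (induction rule: reduced_rep.induct)
  case (word ws d K)
  have C: "C \<ge> 1" using word.prems(3)[of 0] by (simp add: mom_0)
  have cent1: "cent (i, 1) = X i" by (simp add: cent_def mom_one)
  show ?case
  proof (cases "ws = [] \<or> fst (hd ws) \<noteq> i")
    case True
    have "reduced_rep J (Suc d) ((1 + 2 * C) * K) (prod_list (map cent ((i, 1) # ws)))"
    proof (rule reduced_rep.word)
      show "distinct_adj (map fst ((i, 1) # ws))"
        using word True by (cases ws) auto
      show "1 \<le> (1 + 2 * C) * K"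
        using C word mult_mono[of 1 "1 + 2 * C" 1 K] by simp
    qed (use word in auto)
    then show ?thesis using cent1 by simp
  next
    case False
    then obtain e vs where ws: "ws = (i, e) # vs" by (cases ws) auto
    have e: "e \<le> d" using word ws by auto
    have vs: "distinct_adj (map fst vs)" "fst ` set vs \<subseteq> J" "\<forall>p\<in>set vs. snd p \<le> Suc d"
      using word unfolding ws by (auto simp: distinct_adj_Cons)
    have new: "reduced_rep J (Suc d) 1 (prod_list (map cent ((i, e') # vs)))" if "e' \<le> Suc d" for e'
      using vs that word(1-3) unfolding ws
      by (intro reduced_rep.word) (auto simp: distinct_adj_Cons)
    have *: "X i * cent (i, e) = cent (i, Suc e) + (scaleC (mom (Suc e)) 1 + scaleC (- mom e) (cent (i, 1)))"
      unfolding cent1 by (simp add: cent_def algebra_simps scaleC_mult_right)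
    have "X i * prod_list (map cent ws) = prod_list (map cent ((i, Suc e) # vs)) +
      (scaleC (mom (Suc e)) (prod_list (map cent vs)) + scaleC (- mom e) (prod_list (map cent ((i, 1) # vs))))"
      by (simp add: ws * distrib_right left_diff_distrib scaleC_mult_left flip: mult.assoc)
    moreover have "reduced_rep J (Suc d) (1 + (C + C)) \<dots>"
    proof (intro reduced_rep.add)
      show "reduced_rep J (Suc d) C (scaleC (mom (Suc e)) (prod_list (map cent vs)))"
        using word.prems e vs by (intro reduced_rep.scale[OF reduced_rep.word[of _ _ _ 1]]) auto
      show "reduced_rep J (Suc d) C (scaleC (- mom e) (prod_list (map cent ((i, 1) # vs))))"
        by (rule reduced_rep.scale[OF new]) (use word.prems e in auto)
    qed (use new e in auto)
    moreover have "1 + (C + C) \<le> (1 + 2 * C) * K"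
      using C word(4) mult_left_mono[of 1 K "1 + 2 * C"] by simp
    ultimately show ?thesis by (metis reduced_rep_mono)
  qed
next
  case (scale d K x c L)
  have "0 \<le> cmod (mom 0)" "cmod (mom 0) \<le> C" using scale.prems by auto
  then have C: "0 \<le> C" by linarith
  have "cmod c * ((1 + 2 * C) * K) \<le> (1 + 2 * C) * L"
    using scale.hyps(2) C mult_left_mono[of "cmod c * K" L "1 + 2 * C"] by (simp add: mult_ac)
  then show ?case
    using scale by (auto simp: scaleC_mult_right intro: reduced_rep.scale)
next
  case (add d K x L y)
  then show ?case by (auto simp: distrib_left intro: reduced_rep.add)
qed

lemma reduced_rep_word:
  assumes "set w \<subseteq> J" "length w \<le> D" "\<And>e. e \<le> D \<Longrightarrow> cmod (mom e) \<le> C"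
  shows "reduced_rep J (length w) ((1 + 2 * C) ^ length w) (word w)"
  using assms(1,2)
proof (induction w)
  case Nil
  then show ?case using reduced_rep.word[of "[]" J 0 1] by simp
next
  case (Cons i w)
  then show ?case
    using reduced_rep_mult_X[of J "length w" "(1 + 2 * C) ^ length w" "word w" i D C] assms(3)
    by simp
qed

text \<open>By freeness only the empty reduced word has a nonzero expectation, so the total modulus
  of the coefficients is a bound.\<close>

lemma phi_reduced_rep: "reduced_rep J d K x \<Longrightarrow> J \<subseteq> {1..} \<Longrightarrow> cmod
    (phi x) \<le> K"
proof (induction rule: reduced_rep.induct)
  case (word ws d K)
  then show ?case
    using phi_reduced[of ws] by (cases "ws = []") (auto simp: phi_one)
next
  case (scale d K x c L)
  then have "cmod c * cmod (phi x) \<le> cmod c * K" by (intro mult_left_mono) auto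
  then show ?case using scale by (simp add: phi_scale norm_mult)
next
  case (add d K x L y)
  then show ?case by (auto simp: phi_add intro: norm_triangle_mono)
qed

text \<open>The constants of \<open>reduced_rep_word\<close> involve only the moments of order at
  most n, common to all variables, and not the letters of the word.\<close>

lemma phi_word_bound: "\<exists>K. \<forall>w. length w
    = n \<and> set w \<subseteq> {1..} \<longrightarrow> cmod (phi (word w)) \<le> K"
proof -
  define C where "C = (\<Sum>e\<le>n. cmod (mom e))"
  have "cmod (mom e) \<le> C" if "e \<le> n" for e
    unfolding C_def using that by (intro member_le_sum) auto
  then have "cmod (phi (word w)) \<le> (1 + 2 * C) ^ n" if "length w = n" "set w \<subseteq> {1..}" for w
    using reduced_rep_word[of w "{1..}" n C] that by (auto intro!: phi_reduced_rep)
  then show ?thesis by blast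
qed

text \<open>As i lies outside J, putting (i, e) between two reduced words over J creates no equal
  neighbours; freeness annihilates every term of the expansion.\<close>

lemma phi_reduced_rep_sandwich:
  assumes "reduced_rep J d K u" "reduced_rep J d' K' v" "i \<notin> J" "i \<ge> 1" "J \<subseteq> {1..}"
  shows "phi (u * cent (i, e) * v) = 0"
  using assms(1)
proof (induction rule: reduced_rep.induct)
  case (word us d K)
  from assms(2) show ?case
  proof (induction rule: reduced_rep.induct)
    case w: (word vs d' K')
    have "us = [] \<or> last (map fst us) \<noteq> i"
      using word(2) assms(3) last_in_set[of "map fst us"] by auto
    moreover have "vs = [] \<or> i \<noteq> hd (map fst vs)"
      using w(2) assms(3) hd_in_set[of "map fst vs"] by auto
    ultimately have "distinct_adj (map fst (us @ (i, e) # vs))"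
      using word(1) w(1) by (simp add: distinct_adj_append_iff distinct_adj_Cons)
    moreover have "fst ` set (us @ (i, e) # vs) \<subseteq> {1..}"
      using word(2) w(2) assms(4,5) by auto
    ultimately have "phi (prod_list (map cent (us @ (i, e) # vs))) = 0"
      by (intro phi_reduced) auto
    then show ?case by (simp add: mult.assoc)
  qed (auto simp: scaleC_mult_right phi_scale distrib_left phi_add)
qed (auto simp: scaleC_mult_left phi_scale distrib_right phi_add)

lemma phi_word_cent_word:
  assumes "i \<notin> set u" "i \<notin> set v" "i \<ge> 1" "set u \<subseteq> {1..}" "set v \<subseteq> {1..}"
  shows "phi (word u * cent (i, e) * word v) = 0"
proof -
  define n where "n = length u + length v"
  define C where "C = (\<Sum>e\<le>n. cmod (mom e))"
  have "cmod (mom e) \<le> C" if "e \<le> n" for e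
    unfolding C_def using that by (intro member_le_sum) auto
  then have "reduced_rep (set u \<union> set v) (length x) ((1 + 2 * C) ^ length x) (word x)"
    if "x = u \<or> x = v" for x
    using that by (intro reduced_rep_word[of _ _ n C]) (auto simp: n_def)
  then show ?thesis
    using assms by (blast intro: phi_reduced_rep_sandwich)
qed

lemma phi_word_singleton:
  assumes "count_list w i = 1" "set w \<subseteq> {1..}"
  shows "phi (word w) = 0"
proof -
  have "i \<in> set w" using assms(1) by (metis count_notin zero_neq_one)
  then obtain u v where w: "w = u @ i # v" by (meson split_list)
  have "i \<notin> set u" "i \<notin> set v"
    using assms(1) by (auto simp: w count_list_append count_list_0_iff)
  then show ?thesis
    using phi_word_cent_word[of i u v 1] assms(2)
    by (simp add: w cent_def mom_one mult.assoc)
qed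

text \<open>The square of X i is \<open>cent (i, 2)\<close> plus the scalar \<open>mom 2\<close>,
  and the centred part contributes 0 because i occurs nowhere else.\<close>

lemma phi_word_remove_pair:
  assumes "i \<notin> set u" "i \<notin> set v" "i \<ge> 1" "set u \<subseteq> {1..}" "set v \<subseteq> {1..}"
  shows "phi (word (u @ i # i # v)) = mom 2 * phi (word (u @ v))"
proof -
  have "phi (word u * cent (i, 2) * word v) = 0"
    by (rule phi_word_cent_word) fact+
  then show ?thesis
    by (simp add: cent_def power2_eq_square algebra_simps phi_diff phi_scale scaleC_mult_left
        scaleC_mult_right mult.assoc)
qed

lemma not_distinct_adj_split:
  assumes "\<not> distinct_adj w"
  obtains u i v where "w = u @ i # i # v"
proof -
  from assms obtain k where k: "Suc k < length w" "w ! k = w ! Suc k"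
    by (auto simp: distinct_adj_conv_nth)
  have "w = take k w @ w ! k # w ! k # drop (Suc (Suc k)) w"
    using k id_take_nth_drop[of k w] Cons_nth_drop_Suc[of "Suc k" w] by simp
  then show thesis by (rule that)
qed

text \<open>A word without equal neighbours is itself reduced and both sides vanish. Otherwise an
  adjacent pair can be removed on both sides at the same cost; the bound 2 on the counts guarantees
  that its letter does not occur elsewhere.\<close>

lemma phi_word_eq_semicircle_word:
  assumes "\<forall>i. count_list w i \<le> 2" "set w \<subseteq> {1..}"
  shows "phi (word w) = of_real (semicircle_word ((rs_theta phi a)\<^sup>2) w)"
  using assms
proof (induction w rule: length_induct)
  case (1 w)
  consider "w = []" | "w \<noteq> []" "distinct_adj w" | "\<not> distinct_adj w" by blast
  then show ?case
  proof cases
    case 1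
    then show ?thesis by (simp add: phi_one)
  next
    case 2
    have eq: "map cent (map (\<lambda>i. (i, 1)) w) = map X w"
      by (simp add: cent_def mom_one)
    have "phi (prod_list (map cent (map (\<lambda>i. (i, 1)) w))) = 0"
      using 2 "1.prems" by (intro phi_reduced) (auto simp: o_def)
    then have "phi (word w) = 0" unfolding eq .
    then show ?thesis using semicircle_word_distinct_adj[of w] 2 by simp
  next
    case 3
    then obtain u i v where w: "w = u @ i # i # v" by (rule not_distinct_adj_split)
    have "count_list u i + count_list v i = 0"
      using "1.prems"(1)[rule_format, of i] by (simp add: w count_list_append)
    then have i: "i \<notin> set u" "i \<notin> set v"
      by (auto simp: count_list_0_iff)
    have "count_list (u @ v) j \<le> 2" for j
      using "1.prems"(1)[rule_format, of j] by (auto simp: w count_list_append split: if_splits)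
    then have "phi (word (u @ v)) = of_real (semicircle_word ((rs_theta phi a)\<^sup>2) (u @ v))"
      using "1.prems" by (intro "1.IH"[rule_format]) (auto simp: w)
    then show ?thesis
      using phi_word_remove_pair[of i u v] semicircle_word_remove_pair[of i u v] i "1.prems"
      by (simp add: w mom_2)
  qed
qed

section \<open>Moments of the centred partial sums\<close>

definition T :: "nat \<Rightarrow> 'a" where
  "T k = (\<Sum>i=1..k. X i)"

text \<open>Every letter present is counted at least twice and one at least three times, so twice
  the number of letters plus 1 is at most the length.\<close>

lemma card_letters_le:
  assumes "\<forall>i. count_list w i \<noteq> 1" "\<not> (\<forall>i. count_list w i \<le> 2)"
  shows "card (set w) \<le> (length w - 1) div 2"
proof -
  from assms(2) obtain i where "\<not> count_list w i \<le> 2" by blast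
  then have i: "count_list w i \<ge> 3" by simp
  then have "i \<in> set w" using count_notin[of i w] by (cases "i \<in> set w") auto
  have "2 * card (set w) + 1 = (\<Sum>x\<in>set w. 2 + (if x = i then 1 else 0))"
    using \<open>i \<in> set w\<close> unfolding sum.distrib by simp
  also have "\<dots> \<le> (\<Sum>x\<in>set w. count_list w x)"
  proof (rule sum_mono)
    fix x assume "x \<in> set w"
    then have "count_list w x \<noteq> 0" by (simp add: count_list_0_iff)
    then show "2 + (if x = i then 1 else 0) \<le> count_list w x"
      using i assms(1)[rule_format, of x] by auto
  qed
  also have "\<dots> = length w" by (simp add: sum_count_set)
  finally show ?thesis by simp
qed

lemma phi_T_power_asymp:
  assumes "r \<ge> 1"
  shows "\<exists>K\<ge>0. \<forall>k. cmod (phi (T k ^ r)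
      - of_real (semicircle_moment r * (rs_theta phi a * sqrt (real k)) ^ r))
     \<le> K * real k ^ ((r - 1) div 2)"
proof -
  define t where "t = (rs_theta phi a)\<^sup>2"
  define d where "d = (r - 1) div 2"
  obtain K1 where K1: "\<And>w. length w = r \<Longrightarrow> set w \<subseteq> {1..} \<Longrightarrow>
      cmod (phi (word w)) \<le> K1"
    using phi_word_bound[of r] by auto
  define K2 where "K2 = \<bar>K1\<bar> + (1 + \<bar>t\<bar>) ^ r * fact r"
  have K2: "K2 \<ge> 0" by (simp add: K2_def)
  have bound: "cmod (phi (T k ^ r) - of_real (semicircle_moment r * (rs_theta phi a * sqrt (real k)) ^ r))
     \<le> K2 * d ^ r * real k ^ d" for k
  proof -
    define B where "B = {w \<in> words k r. card (set w) \<le> d}"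
    let ?D = "\<lambda>w. phi (word w) - of_real (semicircle_word t w)"
    have B: "finite B" "B \<subseteq> words k r"
      unfolding B_def by auto
    have positive: "set w \<subseteq> {1..}" if "w \<in> words k r" for w
      using that by (auto simp: words_def)
    have zero: "?D w = 0" if "w \<in> words k r - B" for w
    proof (cases "\<forall>i. count_list w i \<le> 2")
      case True
      then show ?thesis
        using that positive[of w] phi_word_eq_semicircle_word[of w] by (simp add: t_def)
    next
      case False
      \<comment> \<open>Some letter occurs three times although the word has more than d letters, so
        by \<open>card_letters_le\<close> another letter occurs exactly once, and this makes both
        terms vanish.\<close>
      have "\<not> card (set w) \<le> d" "length w = r" using that by (auto simp: B_def words_def)
      then obtain i where "count_list w i = 1"
        using card_letters_le[OF _ False] unfolding d_def by blast
      then show ?thesis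
        using that positive[of w] phi_word_singleton[of w i] semicircle_word_singleton[of w i] by simp
    qed
    have "sqrt (t * real k) = rs_theta phi a * sqrt (real k)"
      using rs_theta_nonneg by (simp add: t_def real_sqrt_mult)
    then have "phi (T k ^ r) - of_real (semicircle_moment r * (rs_theta phi a * sqrt (real k)) ^ r) =
        (\<Sum>w\<in>words k r. ?D w)"
      using sum_semicircle_word[of t k r]
      by (simp only: T_def power_sum_words phi_sum sum_subtractf of_real_sum[symmetric])
        (simp add: t_def)
    also have "\<dots> = (\<Sum>w\<in>B. ?D w)"
      using zero B by (intro sum.mono_neutral_right) auto
    also have "cmod \<dots> \<le> (\<Sum>w\<in>B. K2)"
    proof (rule sum_norm_le)
      fix w assume "w \<in> B"
      then have "w \<in> words k r" using B by blast
      then have w: "length w = r" "set w \<subseteq> {1..}" using positive by (auto simp: words_def)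
      have "cmod (?D w) \<le> cmod (phi (word w)) + \<bar>semicircle_word t w\<bar>"
        using norm_triangle_ineq4[of "phi (word w)" "of_real (semicircle_word t w)"]
        unfolding norm_of_real .
      also have "\<dots> \<le> K1 + (1 + \<bar>t\<bar>) ^ r * fact r"
        using K1[OF w] semicircle_word_bound[of t w] unfolding w by (rule add_mono)
      finally show "cmod (?D w) \<le> K2" unfolding K2_def by linarith
    qed
    also have "\<dots> = real (card B) * K2" by simp
    also have "\<dots> \<le> real (d ^ r * k ^ d) * K2"
      unfolding B_def using assms K2 by (intro mult_right_mono of_nat_mono card_words_few_letters) auto
    finally show ?thesis by (simp add: mult_ac)
  qed
  show ?thesis
    unfolding d_def[symmetric]
  proof (intro exI[of _ "K2 * d ^ r"] conjI allI)
    show "0 \<le> K2 * d ^ r" using K2 by simp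
  qed (rule bound)
qed

text \<open>With zero variance each X i is a null element, and expanding the leftmost factor of the
  power puts one at the front of every term, where \<open>phi_null_left\<close> applies.\<close>

lemma phi_T_power_zero:
  assumes "rs_theta phi a = 0" "r \<ge> 1"
  shows "phi (T k ^ r) = 0"
proof -
  from assms(2) obtain n where r: "r = Suc n" by (cases r) auto
  have "phi (X i * z) = 0" if "i \<ge> 1" for i z
  proof (rule phi_null_left)
    show "phi (X i * X i) = 0"
      using phi_X_power[OF that, of 2] unfolding mom_2 assms(1) by (simp add: power2_eq_square)
  qed (rule adj_X[OF that])
  then show ?thesis
    by (simp add: r T_def sum_distrib_right phi_sum)
qed

end

section \<open>Random sums\<close>

text \<open>Removes the odd r, for which the main term would involve a half-integral power of k; for
  even r it is a monomial in k.\<close>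

lemma semicircle_moment_odd: "odd r \<Longrightarrow> semicircle_moment r = 0"
proof (induction r rule: less_induct)
  case (less r)
  show ?case
  proof (cases "r = 1")
    case False
    with less.prems have r: "r = (r - 2) + 2" "odd (r - 2)" by (cases r; auto)+
    then have "semicircle_moment (r - 2) = 0" by (intro less.IH) auto
    then show ?thesis
      using semicircle_moment_rec[of "r - 2"] r(1) by simp
  qed (use semicircle_moment_1 in simp)
qed

text \<open>Telescoping in p. The exponent p in place of the sharper p - 1 is affordable because Z
  is at least 1, and it avoids an exception at p = 0.\<close>

lemma abs_diff_power_le:
  fixes x y Z :: real
  assumes "\<bar>x\<bar> \<le> Z" "\<bar>y\<bar> \<le> Z" "1 \<le> Z"
  shows "\<bar>x ^ p - y ^ p\<bar> \<le> real p * \<bar>x - y\<bar> * Z ^ p"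
proof (induction p)
  case (Suc p)
  have "x ^ Suc p - y ^ Suc p = x * (x ^ p - y ^ p) + (x - y) * y ^ p"
    by (simp add: algebra_simps)
  also have "\<bar>\<dots>\<bar> \<le> \<bar>x\<bar> * \<bar>x ^ p - y ^ p\<bar> + \<bar>x
      - y\<bar> * \<bar>y\<bar> ^ p"
    by (metis abs_mult abs_triangle_ineq power_abs)
  also have "\<dots> \<le> Z * (real p * \<bar>x - y\<bar> * Z ^ p) + \<bar>x - y\<bar> * Z ^ Suc p"
  proof (intro add_mono mult_mono Suc.IH mult_left_mono)
    have "\<bar>y\<bar> ^ p \<le> Z ^ p" using assms by (intro power_mono) auto
    also have "\<dots> \<le> Z ^ Suc p" using assms by (intro power_increasing) auto
    finally show "\<bar>y\<bar> ^ p \<le> Z ^ Suc p" .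
  qed (use assms in auto)
  also have "\<dots> = real (Suc p) * \<bar>x - y\<bar> * Z ^ Suc p"
    by (simp add: algebra_simps)
  finally show ?case .
qed simp

lemma one_plus_power_le:
  fixes x :: real
  assumes "0 \<le> x"
  shows "(1 + x) ^ P \<le> 2 ^ P * (1 + x ^ P)"
proof (cases "x \<le> 1")
  case True
  then have "(1 + x) ^ P \<le> 2 ^ P" using assms by (intro power_mono) auto
  also have "\<dots> \<le> 2 ^ P * (1 + x ^ P)" using assms by simp
  finally show ?thesis .
next
  case False
  then have "(1 + x) ^ P \<le> (2 * x) ^ P" by (intro power_mono) auto
  also have "\<dots> \<le> 2 ^ P * (1 + x ^ P)" by (simp add: power_mult_distrib)
  finally show ?thesis .
qed

section \<open>Functions of polynomial growth and their integrability\<close>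

definition poly_growth :: "(nat \<Rightarrow> 'c::real_normed_vector) \<Rightarrow> bool" where
  "poly_growth f \<longleftrightarrow> (\<exists>C P. \<forall>k. norm (f k) \<le> C * (1 + real k) ^ P)"

lemma poly_growthI: "(\<And>k. norm (f k) \<le> C * (1 + real k) ^ P) \<Longrightarrow> poly_growth f"
  unfolding poly_growth_def by blast

lemma poly_growth_const: "poly_growth (\<lambda>_. c)"
  by (rule poly_growthI[of _ "norm c" 0]) simp

lemma poly_growth_of_nat: "poly_growth real"
  by (rule poly_growthI[of _ 1 1]) simp

lemma poly_growth_add:
  assumes "poly_growth f" "poly_growth g"
  shows "poly_growth (\<lambda>k. f k + g k)"
proof -
  obtain C P D Q where *: "\<And>k. norm (f k) \<le> C * (1 + real k) ^ P" "\<And>k. norm (g k)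
      \<le> D * (1 + real k) ^ Q"
    using assms unfolding poly_growth_def by blast
  have "norm (f k + g k) \<le> (\<bar>C\<bar> + \<bar>D\<bar>) * (1 + real k) ^ (P + Q)" for k
  proof -
    have "norm (f k) \<le> \<bar>C\<bar> * (1 + real k) ^ (P + Q)"
      by (rule order_trans[OF *(1)], rule mult_mono) (auto intro: power_increasing)
    moreover have "norm (g k) \<le> \<bar>D\<bar> * (1 + real k) ^ (P + Q)"
      by (rule order_trans[OF *(2)], rule mult_mono) (auto intro: power_increasing)
    ultimately show ?thesis
      using norm_triangle_ineq[of "f k" "g k"] by (simp add: algebra_simps)
  qed
  then show ?thesis by (rule poly_growthI)
qed

lemma poly_growth_mult:
  fixes f g :: "nat \<Rightarrow> 'c::real_normed_algebra"
  assumes "poly_growth f" "poly_growth g"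
  shows "poly_growth (\<lambda>k. f k * g k)"
proof -
  obtain C P D Q where *: "\<And>k. norm (f k) \<le> C * (1 + real k) ^ P" "\<And>k. norm (g k)
      \<le> D * (1 + real k) ^ Q"
    using assms unfolding poly_growth_def by blast
  have "norm (f k * g k) \<le> (C * D) * (1 + real k) ^ (P + Q)" for k
  proof -
    have "norm (f k * g k) \<le> (C * (1 + real k) ^ P) * (D * (1 + real k) ^ Q)"
      by (rule order_trans[OF norm_mult_ineq], rule mult_mono)
        (auto intro: * order_trans[OF norm_ge_zero *(1)])
    then show ?thesis by (simp add: power_add mult_ac)
  qed
  then show ?thesis by (rule poly_growthI)
qed

lemma poly_growth_sum:
  "(\<And>i. i \<in> A \<Longrightarrow> poly_growth (f i)) \<Longrightarrow> poly_growth
      (\<lambda>k. \<Sum>i\<in>A. f i k)"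
  by (induction A rule: infinite_finite_induct) (auto intro: poly_growth_const poly_growth_add)

lemma poly_growth_power:
  fixes f :: "nat \<Rightarrow> 'c::real_normed_algebra_1"
  shows "poly_growth f \<Longrightarrow> poly_growth (\<lambda>k. f k ^ n)"
  by (induction n) (auto intro: poly_growth_const poly_growth_mult)

lemma poly_growth_of_real:
  "poly_growth f \<Longrightarrow> poly_growth (\<lambda>k. of_real (f k) :: 'c::real_normed_algebra_1)"
  unfolding poly_growth_def by simp

lemma poly_growth_diff: "poly_growth f \<Longrightarrow> poly_growth g \<Longrightarrow> poly_growth
    (\<lambda>k. f k - g k)"
  using poly_growth_add[of f "\<lambda>k. - g k"] by (simp add: poly_growth_def)

lemma poly_growth_abs: "poly_growth f \<Longrightarrow> poly_growth (\<lambda>k. \<bar>f k\<bar> :: real)"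
  unfolding poly_growth_def by simp

lemma poly_growth_sqrt: "poly_growth (\<lambda>k. sqrt (real k))"
proof (rule poly_growthI[of _ 1 1])
  fix k
  have "sqrt (real k) \<le> sqrt ((1 + real k) ^ 2)"
    by (rule real_sqrt_le_mono) (simp add: power2_eq_square algebra_simps)
  then show "norm (sqrt (real k)) \<le> 1 * (1 + real k) ^ 1" by simp
qed

lemmas poly_growth_intros = poly_growth_const poly_growth_of_nat poly_growth_add poly_growth_diff
  poly_growth_mult poly_growth_sum poly_growth_power poly_growth_of_real poly_growth_abs poly_growth_sqrt

text \<open>The integral of a non-integrable function is 0 by default, so every estimate between
  expectations must come with integrability. Finite moments of all orders give it for any function
  of polynomial growth.\<close>

lemma integrable_poly_growth:
  fixes f :: "nat \<Rightarrow> 'c::{banach, second_countable_topology}"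
  assumes K: "K \<in> measurable M (count_space UNIV)" and int:
      "\<And>m. integrable M (\<lambda>w. real (K w) ^ m)"
    and f: "poly_growth f"
  shows "integrable M (\<lambda>w. f (K w))"
proof -
  obtain C P where *: "\<And>k. norm (f k) \<le> C * (1 + real k) ^ P"
    using f unfolding poly_growth_def by blast
  have "(\<lambda>w. C * (1 + real (K w)) ^ P) = (\<lambda>w. C * (\<Sum>j\<le>P. of_nat (P choose j)
      * real (K w) ^ (P - j)))"
    by (simp add: binomial_ring)
  then have "integrable M (\<lambda>w. C * (1 + real (K w)) ^ P)"
    using int by simp
  then show ?thesis
  proof (rule Bochner_Integration.integrable_bound)
    show "(\<lambda>w. f (K w)) \<in> borel_measurable M"
      by (rule measurable_compose[OF K]) simp
    show "AE w in M. norm (f (K w)) \<le> norm (C * (1 + real (K w)) ^ P)"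
      by (intro AE_I2 order_trans[OF *]) simp
  qed
qed

lemma norm_integral_diff_le:
  fixes f g :: "'w \<Rightarrow> 'c::{banach, second_countable_topology}"
  assumes "integrable M f" "integrable M g" "integrable M h" "\<And>w. norm (f w - g w) \<le> e * h w"
  shows "norm (integral\<^sup>L M f - integral\<^sup>L M g) \<le> e * integral\<^sup>L M h"
proof -
  have "integral\<^sup>L M f - integral\<^sup>L M g = (\<integral>w. f w - g w \<partial>M)"
    using assms by simp
  also have "norm \<dots> \<le> (\<integral>w. e * h w \<partial>M)"
    using assms by (intro order_trans[OF integral_norm_bound] Bochner_Integration.integral_mono) auto
  finally show ?thesis using assms by simp
qed

lemma (in star_prob_space) scaleC_one_power: "(scaleC d 1) ^ l = scaleC (d ^ l) 1"
  by (induction l) (simp_all add: scaleC_mult_left)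

lemma (in star_prob_space) scale_power: "scaleC b x ^ m = scaleC (b ^ m) (x ^ m)"
  by (induction m) (simp_all add: scaleC_mult_left scaleC_mult_right)

text \<open>Applied with x a partial sum and with x = s, this gives both sides of (i) the same
  expansion, so that they can be compared moment by moment.\<close>

lemma (in star_prob_space) phi_scalar_binomial:
  "phi ((scaleC b x + scaleC c 1) ^ m * scaleC d 1 ^ l) =
     (\<Sum>r\<le>m. of_nat (m choose r) * (c ^ (m - r) * d ^ l) * (b ^ r * phi (x ^ r)))"
  unfolding scalar_binomial scaleC_one_power
  by (simp add: scaleC_mult_right phi_scale phi_sum sum_distrib_left mult_ac)

section \<open>Moments of the normalized sums\<close>

context free_iid_family
begin

lemma partial_sum_eq: "partial_sum a k = T k + scaleC (of_nat k * phi (a 1)) 1"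
  by (induction k) (simp_all add: partial_sum_def T_def X_def scale_left_distrib algebra_simps)

text \<open>This gives the normalized sum the shape of the right side of (i): the same scalar, plus
  T / \<sigma> in the place of sqrt (1 - \<delta>^2) s.\<close>

lemma rs_S_tilde_eq:
  "rs_S_tilde scaleC phi a M N n w = scaleC (of_real (1 / rs_sigma phi a M N n)) (T (N n w)) +
     scaleC (of_real (rs_delta_N_tilde phi a M N n w)) 1"
  unfolding rs_S_tilde_def rs_delta_N_tilde_def partial_sum_eq scalar_elem_def phi_a_real
  by (simp add: scale_right_distrib scale_right_diff_distrib algebra_simps diff_divide_distrib
      scale_left_diff_distrib)

lemma poly_growth_phi_T: "poly_growth (\<lambda>k. phi (T k ^ r))"
proof (cases "r = 0")
  case False
  then obtain K where K: "\<And>k. cmod (phi (T k ^ r)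
      - of_real (semicircle_moment r * (rs_theta phi a * sqrt (real k)) ^ r))
     \<le> K * real k ^ ((r - 1) div 2)" "K \<ge> 0"
    using phi_T_power_asymp[of r] by auto
  have "poly_growth (\<lambda>k. phi (T k ^ r) - of_real (semicircle_moment r * (rs_theta phi a
      * sqrt (real k)) ^ r))"
    by (rule poly_growthI[of _ K "(r - 1) div 2"], rule order_trans[OF K(1)])
      (use K(2) in \<open>auto intro!: mult_left_mono power_mono\<close>)
  from poly_growth_add[OF this, of "\<lambda>k. of_real (semicircle_moment r * (rs_theta phi a
      * sqrt (real k)) ^ r)"]
  show ?thesis by (simp add: poly_growth_intros)
qed (simp add: phi_one poly_growth_const)

text \<open>Here \<open>rs_theta phi a * sqrt et / sg\<close> stands for sqrt (1 - \<delta>^2). The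
  real parameters sg and et are left free so that C cannot depend on n. The error has two sources:
  the asymptotics of \<open>phi (T k ^ r)\<close>, and the replacement of k by et in the main
  term.\<close>

lemma normalized_moment_noncentred:
  assumes "rs_alpha phi a \<noteq> 0"
  shows "\<exists>C\<ge>0. \<forall>sg\<ge>1. \<forall>et\<ge>0. et * (rs_theta phi a)\<^sup>2
      \<le> sg\<^sup>2 \<longrightarrow>
    (\<forall>k. cmod (of_real (1 / sg) ^ r * phi (T k ^ r)
        - of_real (semicircle_moment r * (rs_theta phi a * sqrt et / sg) ^ r))
       \<le> C / sg * (1 + \<bar>rs_alpha phi a * (real k - et) / sg\<bar>) ^ r)"
proof -
  define al where "al = rs_alpha phi a"
  define th where "th = rs_theta phi a"
  have al: "al \<noteq> 0" using assms by (simp add: al_def)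
  consider "r = 0" | "th = 0" "r \<ge> 1" | "th > 0" "r \<ge> 1"
    using rs_theta_nonneg by (fastforce simp: th_def)
  then show ?thesis
  proof cases
    case 1
    then show ?thesis by (intro exI[of _ 0]) (simp add: phi_one semicircle_moment_0)
  next
    case 2
    then show ?thesis by (intro exI[of _ 0]) (auto simp: phi_T_power_zero th_def)
  next
    case 3
    define d where "d = (r - 1) div 2"
    define p where "p = r div 2"
    obtain K where K: "\<And>k. cmod (phi (T k ^ r) - of_real (semicircle_moment r * (th * sqrt (real k)) ^ r))
       \<le> K * real k ^ d" "K \<ge> 0"
      using phi_T_power_asymp[OF 3(2)] by (auto simp: th_def d_def)
    \<comment> \<open>\<open>A\<close> makes k / sg^2 at most A (1 + |c|) for c = al (k - et) / sg;
      \<open>B\<close> bounds the same ratio times th^2 with room for 1; \<open>C2\<close> is the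
      constant of the telescoping estimate for p-th powers.\<close>
    define A where "A = 1 / th\<^sup>2 + 1 / \<bar>al\<bar>"
    define B where "B = 1 + th\<^sup>2 * A"
    define C2 where "C2 = \<bar>semicircle_moment r\<bar> * (real p * (th\<^sup>2 / \<bar>al\<bar>) * B ^ p)"
    have A: "A \<ge> 0" and B: "B \<ge> 1" and C2: "C2 \<ge> 0" by (simp_all add: A_def B_def C2_def)
    show ?thesis
    proof (intro exI[of _ "K * A ^ d + C2"] conjI allI impI)
      show "0 \<le> K * A ^ d + C2" using K A C2 by simp
    next
      fix sg et :: real and k :: nat
      assume sg: "1 \<le> sg" and et: "0 \<le> et" and le: "et * (rs_theta phi a)\<^sup>2 \<le> sg\<^sup>2"
      define c where "c = al * (real k - et) / sg"
      have k: "real k - et = sg * c / al" using al sg by (simp add: c_def)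
      have et_le: "et / sg\<^sup>2 \<le> 1 / th\<^sup>2"
        using le 3(1) sg by (simp add: th_def field_simps)
      have "real k / sg\<^sup>2 = et / sg\<^sup>2 + (c / al) / sg"
        using k sg by (simp add: field_simps power2_eq_square)
      moreover have "(c / al) / sg \<le> \<bar>c\<bar> / \<bar>al\<bar>"
      proof -
        have "(c / al) / sg \<le> \<bar>c / al\<bar> / sg" using sg by (intro divide_right_mono abs_ge_self) auto
        also have "\<dots> \<le> \<bar>c / al\<bar> / 1" using sg by (intro divide_left_mono) auto
        finally show ?thesis unfolding abs_divide div_by_1 .
      qed
      ultimately have "real k / sg\<^sup>2 \<le> 1 / th\<^sup>2 + \<bar>c\<bar> / \<bar>al\<bar>" using
          et_le by linarith
      also have "\<dots> \<le> A * (1 + \<bar>c\<bar>)"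
        by (simp add: A_def distrib_left distrib_right)
      finally have k_le: "real k / sg\<^sup>2 \<le> A * (1 + \<bar>c\<bar>)" .

      have "cmod (of_real (1 / sg) ^ r * (phi (T k ^ r)
          - of_real (semicircle_moment r * (th * sqrt (real k)) ^ r)))
          \<le> (1 / sg) ^ r * (K * real k ^ d)"
        unfolding norm_mult norm_power norm_of_real using sg
        by (intro mult_mono K) auto
      \<comment> \<open>Since 2 d + 1 <= r and sg >= 1, d factors 1 / sg^2 can be matched with k^d,
        and the remaining 1 / sg is the gain.\<close>
      also have "\<dots> \<le> (1 / sg) ^ (2 * d + 1) * (K * real k ^ d)"
        using sg K(2) 3(2) by (intro mult_right_mono power_decreasing) (auto simp: d_def)
      also have "\<dots> = K / sg * (real k / sg\<^sup>2) ^ d"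
        by (simp add: power_divide power_mult)
      also have "\<dots> \<le> K / sg * (A * (1 + \<bar>c\<bar>)) ^ d"
        using sg K(2) by (intro mult_left_mono power_mono k_le) auto
      also have "\<dots> = (K / sg * A ^ d) * (1 + \<bar>c\<bar>) ^ d"
        by (simp add: power_mult_distrib)
      also have "\<dots> \<le> (K / sg * A ^ d) * (1 + \<bar>c\<bar>) ^ r"
        using sg K(2) A by (intro mult_left_mono power_increasing) (auto simp: d_def)
      finally have first: "cmod (of_real (1 / sg) ^ r * (phi (T k ^ r)
          - of_real (semicircle_moment r * (th * sqrt (real k)) ^ r)))
          \<le> (K / sg * A ^ d) * (1 + \<bar>c\<bar>) ^ r" .

      have second: "\<bar>semicircle_moment r * ((th * sqrt (real k) / sg) ^ r - (th * sqrt et / sg) ^ r)\<bar>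
          \<le> C2 / sg * (1 + \<bar>c\<bar>) ^ r"
      proof (cases "odd r")
        case True
        then show ?thesis using C2 sg by (simp add: semicircle_moment_odd)
      next
        case False
        then have r: "r = 2 * p" "p \<ge> 1" using 3(2) by (auto simp: p_def)
        \<comment> \<open>For even r the two main terms are p-th powers of x and y, which are linear
          in k and in et.\<close>
        define x where "x = th\<^sup>2 * (real k / sg\<^sup>2)"
        define y where "y = th\<^sup>2 * (et / sg\<^sup>2)"
        define Z where "Z = B * (1 + \<bar>c\<bar>)"
        have Z1: "1 \<le> Z" using mult_mono[of 1 B 1 "1 + \<bar>c\<bar>"] B by (simp add: Z_def)
        have "x \<le> th\<^sup>2 * (A * (1 + \<bar>c\<bar>))" unfolding x_def by (intro mult_left_mono k_le) auto
        also have "\<dots> \<le> Z" by (simp add: Z_def B_def distrib_right)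
        finally have x: "\<bar>x\<bar> \<le> Z" by (simp add: x_def)
        have "y \<le> 1" using mult_left_mono[OF et_le, of "th\<^sup>2"] 3(1) by (simp add: y_def)
        then have y: "\<bar>y\<bar> \<le> Z" using Z1 et by (simp add: y_def)
        have "x - y = th\<^sup>2 * ((real k - et) / sg\<^sup>2)"
          by (simp add: x_def y_def algebra_simps diff_divide_distrib)
        \<comment> \<open>One of the two factors 1 / sg is spent on writing k - et in terms of c;
          the other one is the error bound.\<close>
        also have "\<dots> = th\<^sup>2 / al * c / sg"
          unfolding k using sg by (simp add: power2_eq_square)
        finally have xy: "\<bar>x - y\<bar> = th\<^sup>2 / \<bar>al\<bar> * \<bar>c\<bar> / sg"
          using sg by (simp add: abs_mult)
        have pw: "(th * sqrt (real k) / sg) ^ r = x ^ p" "(th * sqrt et / sg) ^ r = y ^ p"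
          using et by (simp_all add: r x_def y_def power_mult power_divide power_mult_distrib)
        have "\<bar>semicircle_moment r * ((th * sqrt (real k) / sg) ^ r - (th * sqrt et / sg) ^ r)\<bar>
            \<le> \<bar>semicircle_moment r\<bar> * (real p * (th\<^sup>2 / \<bar>al\<bar>
                * \<bar>c\<bar> / sg) * Z ^ p)"
          unfolding pw abs_mult xy[symmetric] by (intro mult_left_mono abs_diff_power_le x y Z1) simp
        also have "\<dots> = C2 / sg * (\<bar>c\<bar> * (1 + \<bar>c\<bar>) ^ p)"
          by (simp add: C2_def Z_def power_mult_distrib)
        also have "\<dots> \<le> C2 / sg * ((1 + \<bar>c\<bar>) * (1 + \<bar>c\<bar>) ^ p)"
          using C2 sg by (intro mult_left_mono mult_right_mono) auto
        also have "(1 + \<bar>c\<bar>) * (1 + \<bar>c\<bar>) ^ p = (1 + \<bar>c\<bar>) ^ (p + 1)" by simp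
        \<comment> \<open>The extra factor 1 + |c| fits because p + 1 <= 2 p = r, as p is at least
          1.\<close>
        also have "C2 / sg * (1 + \<bar>c\<bar>) ^ (p + 1) \<le> C2 / sg * (1 + \<bar>c\<bar>) ^ r"
          using C2 sg r by (intro mult_left_mono power_increasing) auto
        finally show ?thesis .
      qed

      have "of_real (1 / sg) ^ r * phi (T k ^ r) - of_real (semicircle_moment r * (th * sqrt et / sg) ^ r) =
         of_real (1 / sg) ^ r * (phi (T k ^ r) - of_real (semicircle_moment r * (th * sqrt (real k)) ^ r)) +
         of_real (semicircle_moment r * ((th * sqrt (real k) / sg) ^ r - (th * sqrt et / sg) ^ r))"
        by (simp add: algebra_simps power_divide power_mult_distrib)
      also have "cmod \<dots> \<le> (K / sg * A ^ d) * (1 + \<bar>c\<bar>) ^ r + C2 / sg * (1 + \<bar>c\<bar>) ^ r"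
        using second by (intro norm_triangle_mono first) (simp only: norm_of_real)
      also have "\<dots> = (K * A ^ d + C2) / sg * (1 + \<bar>c\<bar>) ^ r"
        by (simp add: algebra_simps add_divide_distrib)
      finally show "cmod (of_real (1 / sg) ^ r * phi (T k ^ r)
          - of_real (semicircle_moment r * (rs_theta phi a * sqrt et / sg) ^ r))
       \<le> (K * A ^ d + C2) / sg * (1 + \<bar>rs_alpha phi a * (real k - et) / sg\<bar>) ^ r"
        by (simp only: th_def c_def al_def)
    qed
  qed
qed

text \<open>Without a mean, \<sigma> is \<theta> sqrt et and the main term may keep k / et, so the
  asymptotics alone suffice: of the r factors 1 / sqrt et, 2 d pair with k^d and at least one is
  left over.\<close>

lemma normalized_moment_centred:
  assumes "rs_theta phi a > 0"
  shows "\<exists>C\<ge>0. \<forall>et\<ge>1. \<forall>k. cmod (of_real (1 / (rs_theta phi a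
      * sqrt et)) ^ r * phi (T k ^ r) -
       of_real (semicircle_moment r * sqrt (real k / et) ^ r)) \<le> C / sqrt et * (real k / et) ^ ((r - 1) div 2)"
proof (cases "r = 0")
  case True
  then show ?thesis by (intro exI[of _ 0]) (simp add: phi_one semicircle_moment_0)
next
  case False
  define th where "th = rs_theta phi a"
  define d where "d = (r - 1) div 2"
  have th: "th > 0" using assms by (simp add: th_def)
  obtain K where K: "\<And>k. cmod (phi (T k ^ r) - of_real (semicircle_moment r * (th * sqrt (real k)) ^ r))
     \<le> K * real k ^ d" "K \<ge> 0"
    using phi_T_power_asymp[of r] False by (auto simp: th_def d_def)
  show ?thesis
    unfolding d_def[symmetric] th_def[symmetric]
  proof (intro exI[of _ "K / th ^ r"] conjI allI impI)
    fix et :: real and k :: nat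
    assume et: "1 \<le> et"
    have "of_real (1 / (th * sqrt et)) ^ r * phi (T k ^ r)
        - of_real (semicircle_moment r * sqrt (real k / et) ^ r) =
        of_real (1 / (th * sqrt et)) ^ r * (phi (T k ^ r)
            - of_real (semicircle_moment r * (th * sqrt (real k)) ^ r))"
      using th et by (simp add: algebra_simps power_divide power_mult_distrib real_sqrt_divide)
    also have "cmod \<dots> \<le> (1 / (th * sqrt et)) ^ r * (K * real k ^ d)"
      unfolding norm_mult norm_power norm_of_real using th et
      by (intro mult_mono K) auto
    also have "\<dots> = K / th ^ r * real k ^ d * (1 / sqrt et) ^ r"
      by (simp add: power_divide power_mult_distrib)
    also have "\<dots> \<le> K / th ^ r * real k ^ d * (1 / sqrt et) ^ (2 * d + 1)"
      using th et K(2) False by (intro mult_left_mono power_decreasing) (auto simp: d_def)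
    also have "(1 / sqrt et) ^ (2 * d + 1) = 1 / et ^ d * (1 / sqrt et)"
      using et by (simp add: power_divide power_mult)
    finally show "cmod (of_real (1 / (th * sqrt et)) ^ r * phi (T k ^ r) -
       of_real (semicircle_moment r * sqrt (real k / et) ^ r)) \<le> K / th ^ r / sqrt et * (real k / et) ^ d"
      by (simp add: power_divide mult_ac)
  qed (use K th in auto)
qed

end

theorem theorem4p2:
  fixes scaleC :: "complex \<Rightarrow> 'a::ring_1 \<Rightarrow> 'a"
    and adj :: "'a \<Rightarrow> 'a"
    and phi :: "'a \<Rightarrow> complex"
    and a :: "nat \<Rightarrow> 'a"
    and M :: "'w measure"
    and N :: "nat \<Rightarrow> 'w \<Rightarrow> nat"
    and scaleC' :: "complex \<Rightarrow> 'b::ring_1 \<Rightarrow> 'b"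
    and adj' :: "'b \<Rightarrow> 'b"
    and psi :: "'b \<Rightarrow> complex"
    and s :: 'b
  assumes "star_prob_space scaleC adj phi"
    and "\<forall>i\<ge>1. adj (a i) = a i"
    and "free_variables scaleC adj phi {1..} a"
    and "\<forall>i\<ge>1. \<forall>m. phi (a i ^ m) = phi (a 1 ^ m)"
    and "prob_space M"
    and "\<forall>n\<ge>1. N n \<in> measurable M (count_space UNIV)"
    and "\<forall>n\<ge>1. \<forall>m. integrable M (\<lambda>w. real (N n w) ^ m)"
    and "star_prob_space scaleC' adj' psi"
    and "standard_semicircular adj' psi s"
  shows
    "(phi (a 1) \<noteq> 0 \<and>
      filterlim (\<lambda>n. rs_eta M N n) at_top sequentially \<and>
      filterlim (\<lambda>n. (rs_sigma phi a M N n)\<^sup>2) at_top sequentially \<and>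
      (\<forall>m\<ge>1. (\<lambda>n. prob_space.expectation M (\<lambda>w. \<bar>real (N n w)
          - rs_eta M N n\<bar> ^ m))
                \<in> O(\<lambda>n. rs_sigma phi a M N n ^ m))
      \<longrightarrow>
      (\<forall>m l. (\<lambda>n.
          ext_state M phi (\<lambda>w. rs_S_tilde scaleC phi a M N n w ^ m *
                               scalar_elem scaleC (rs_delta_N_tilde phi a M N n w) ^ l)
        - ext_state M psi (\<lambda>w.
            (scalar_elem scaleC' (rs_delta_N_tilde phi a M N n w) +
             scaleC' (complex_of_real (sqrt (1 - (rs_delta phi a M N n)\<^sup>2))) s) ^ m *
            scalar_elem scaleC' (rs_delta_N_tilde phi a M N n w) ^ l))
        \<in> o(\<lambda>n. 1)))
     \<and>
     (phi (a 1) = 0 \<and> rs_theta phi a > 0 \<and>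
      filterlim (\<lambda>n. rs_eta M N n) at_top sequentially \<and>
      (\<forall>m\<ge>1. limsup (\<lambda>n. ereal (prob_space.expectation M
                (\<lambda>w. (real (N n w) / rs_eta M N n) ^ m))) < \<infinity>)
      \<longrightarrow>
      (\<forall>m l. (\<lambda>n.
          ext_state M phi (\<lambda>w. rs_S_tilde scaleC phi a M N n w ^ m *
                               scalar_elem scaleC (real (N n w) / rs_eta M N n) ^ l)
        - complex_of_real (prob_space.expectation M
              (\<lambda>w. rpow (real (N n w) / rs_eta M N n) (real l + real m / 2))) *
          psi (s ^ m))
        \<in> o(\<lambda>n. 1)))"
proof (intro conjI impI allI)
  interpret prob_space M by fact
  interpret A: free_iid_family scaleC adj phi a
    by (intro free_iid_family.intro free_iid_family_axioms.intro) (use assms(1-4) in blast)+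
  interpret S: star_prob_space scaleC' adj' psi by fact
  have psi_s: "psi (s ^ m) = of_real (semicircle_moment m)" for m
    using assms(9) by (simp add: standard_semicircular_def semicircle_moment_def)
  have N: "N n \<in> measurable M (count_space UNIV)" "integrable M (\<lambda>w. real (N n w) ^ m)" if
      "n \<ge> 1" for n m
    using assms(6,7) that by auto
  have int: "integrable M (\<lambda>w. f (N n w))" if "n \<ge> 1" "poly_growth f"
    for n and f :: "nat \<Rightarrow> 'c::{banach, second_countable_topology}"
    using N[OF that(1)] that(2) by (rule integrable_poly_growth)
  have eta: "rs_eta M N n \<ge> 0" for n
    unfolding rs_eta_def by (rule Bochner_Integration.integral_nonneg) simp
  define al where "al = rs_alpha phi a"
  define th where "th = rs_theta phi a"

  \<comment> \<open>Part (i): variables with nonzero mean\<close>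
  {
    assume hyp: "phi (a 1) \<noteq> 0 \<and>
      filterlim (\<lambda>n. rs_eta M N n) at_top sequentially \<and>
      filterlim (\<lambda>n. (rs_sigma phi a M N n)\<^sup>2) at_top sequentially \<and>
      (\<forall>m\<ge>1. (\<lambda>n. expectation (\<lambda>w. \<bar>real (N n w) - rs_eta M N n\<bar> ^ m))
                \<in> O(\<lambda>n. rs_sigma phi a M N n ^ m))"
    define et where "et n = rs_eta M N n" for n
    define sg where "sg n = rs_sigma phi a M N n" for n
    define c where "c n k = al * (real k - et n) / sg n" for n k
    define q where "q n = sqrt (1 - (rs_delta phi a M N n)\<^sup>2)" for n
    have al: "al \<noteq> 0" using hyp A.phi_a_real by (auto simp: al_def)
    have c: "rs_delta_N_tilde phi a M N n w = c n (N n w)" for n w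
      by (simp add: c_def rs_delta_N_tilde_def al_def et_def sg_def)
    have sg_sq: "(sg n)\<^sup>2 = et n * th\<^sup>2 + (rs_gamma M N n)\<^sup>2 * al\<^sup>2" for n
      using eta[of n] by (simp add: sg_def et_def th_def al_def rs_sigma_def)
    \<comment> \<open>By the definition of \<sigma>, 1 - \<delta>^2 is the share of \<sigma>^2 that
      comes from \<eta> \<theta>^2.\<close>
    have q: "q n = th * sqrt (et n) / sg n" if "sg n > 0" for n
    proof -
      have "(rs_gamma M N n)\<^sup>2 * al\<^sup>2 = (sg n)\<^sup>2 - th\<^sup>2 * et n"
        using sg_sq[of n] by (simp add: mult.commute)
      moreover have "(rs_delta phi a M N n)\<^sup>2 = (rs_gamma M N n)\<^sup>2 * al\<^sup>2 / (sg n)\<^sup>2"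
        by (simp add: rs_delta_def sg_def al_def power_divide power_mult_distrib)
      ultimately have "1 - (rs_delta phi a M N n)\<^sup>2 = th\<^sup>2 * et n / (sg n)\<^sup>2"
        using that by (simp add: diff_divide_distrib)
      then show ?thesis
        using that A.rs_theta_nonneg by (simp add: q_def real_sqrt_divide real_sqrt_mult th_def)
    qed
    have sg_top: "filterlim sg at_top sequentially"
    proof -
      have "filterlim (\<lambda>n. sqrt ((sg n)\<^sup>2)) at_top sequentially"
        using hyp unfolding sg_def by (intro filterlim_compose[OF sqrt_at_top]) auto
      moreover have "sg n \<ge> 0" for n
        using eta[of n] by (simp add: sg_def rs_sigma_def)
      ultimately show ?thesis by simp
    qed
    then have sg_1: "eventually (\<lambda>n. sg n \<ge> 1) sequentially"
      by (simp add: filterlim_at_top)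

    fix m l :: nat
    \<comment> \<open>The summand 1 keeps the exponent positive for m = l = 0, since the moment
      hypothesis starts at exponent 1.\<close>
    define P where "P = m + l + 1"
    obtain C where C: "\<And>r. C r \<ge> 0" "\<And>r sg et k. 1 \<le> sg \<Longrightarrow> 0
        \<le> et \<Longrightarrow> et * th\<^sup>2 \<le> sg\<^sup>2 \<Longrightarrow>
        cmod (of_real (1 / sg) ^ r * phi (A.T k ^ r) - of_real (semicircle_moment r * (th * sqrt et / sg) ^ r))
       \<le> C r / sg * (1 + \<bar>al * (real k - et) / sg\<bar>) ^ r"
      using A.normalized_moment_noncentred al unfolding al_def th_def by metis
    define C' where "C' = (\<Sum>r\<le>m. real (m choose r) * C r)"
    obtain D where D: "D > 0"
      "eventually (\<lambda>n. norm (expectation (\<lambda>w. \<bar>real (N n w) - et n\<bar> ^ P))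
          \<le> D * norm (sg n ^ P)) sequentially"
    proof -
      have "(\<lambda>n. expectation (\<lambda>w. \<bar>real (N n w)
          - et n\<bar> ^ P)) \<in> O(\<lambda>n. sg n ^ P)"
        using hyp by (auto simp: P_def et_def sg_def)
      then show thesis using that by (elim landau_o.bigE) auto
    qed
    define F :: "nat \<Rightarrow> nat \<Rightarrow> complex" where "F n k
        = (\<Sum>r\<le>m. of_nat (m choose r) * (of_real (c n k) ^ (m - r) * of_real (c n k) ^ l) *
        (of_real (1 / sg n) ^ r * phi (A.T k ^ r)))" for n k
    define G :: "nat \<Rightarrow> nat \<Rightarrow> complex" where "G n k
        = (\<Sum>r\<le>m. of_nat (m choose r) * (of_real (c n k) ^ (m - r) * of_real (c n k) ^ l) *
        (of_real (q n) ^ r * of_real (semicircle_moment r)))" for n k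
    have F: "ext_state M phi (\<lambda>w. rs_S_tilde scaleC phi a M N n w ^ m *
         scalar_elem scaleC (rs_delta_N_tilde phi a M N n w) ^ l) = (\<integral>w. F n (N n w) \<partial>M)" for n
      unfolding ext_state_def A.rs_S_tilde_eq scalar_elem_def A.phi_scalar_binomial F_def c sg_def ..
    have G: "ext_state M psi (\<lambda>w.
            (scalar_elem scaleC' (rs_delta_N_tilde phi a M N n w) +
             scaleC' (complex_of_real (sqrt (1 - (rs_delta phi a M N n)\<^sup>2))) s) ^ m *
            scalar_elem scaleC' (rs_delta_N_tilde phi a M N n w) ^ l)
                = (\<integral>w. G n (N n w) \<partial>M)" for n
      unfolding ext_state_def scalar_elem_def add.commute[of "scaleC' _ 1"]
        S.phi_scalar_binomial G_def c q_def psi_s ..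
    have pg_c: "poly_growth (c n)" for n
    proof -
      have "poly_growth (\<lambda>k. (al / sg n) * (real k - et n))" by (intro poly_growth_intros)
      then show ?thesis by (simp add: c_def[abs_def])
    qed
    have pg_F: "poly_growth (F n)" and pg_G: "poly_growth (G n)" for n
      unfolding F_def G_def by (intro poly_growth_intros A.poly_growth_phi_T pg_c)+
    have pointwise: "norm (F n k - G n k) \<le> C' / sg n
        * (1 + \<bar>c n k\<bar>) ^ P" if n: "sg n \<ge> 1" for n k
    proof -
      have "et n * th\<^sup>2 \<le> (sg n)\<^sup>2" by (simp add: sg_sq)
      then have bound: "cmod (of_real (1 / sg n) ^ r * phi (A.T k ^ r)
          - of_real (q n) ^ r * of_real (semicircle_moment r))
         \<le> C r / sg n * (1 + \<bar>c n k\<bar>) ^ r" for r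
        using C(2)[of "sg n" "et n" r k] n eta[of n] q[of n] by (simp add: c_def et_def mult.commute)
      have diff: "F n k - G n k = (\<Sum>r\<le>m. of_nat (m choose r) * of_real (c n k) ^ (m - r + l) *
          (of_real (1 / sg n) ^ r * phi (A.T k ^ r) - of_real (q n) ^ r * of_real (semicircle_moment r)))"
        unfolding F_def G_def sum_subtractf[symmetric] by (intro sum.cong refl)
            (simp only: power_add right_diff_distrib mult_ac)
      have "norm (F n k - G n k) \<le> (\<Sum>r\<le>m. real (m choose r) * C r / sg n
          * (1 + \<bar>c n k\<bar>) ^ P)"
        unfolding diff
      proof (rule sum_norm_le)
        fix r assume r: "r \<in> {..m}"
        have "norm (of_nat (m choose r) * of_real (c n k) ^ (m - r + l) *
            (of_real (1 / sg n) ^ r * phi (A.T k ^ r) - of_real (q n) ^ r * of_real (semicircle_moment r)))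
          = real (m choose r) * \<bar>c n k\<bar> ^ (m
              - r + l) * norm (of_real (1 / sg n) ^ r * phi (A.T k ^ r) - of_real (q n) ^ r * of_real (semicircle_moment r))"
          by (simp only: norm_mult norm_power norm_of_real norm_of_nat)
        also have "\<dots> \<le> real (m choose r) * (1 + \<bar>c n k\<bar>) ^ (m
            - r + l) * (C r / sg n * (1 + \<bar>c n k\<bar>) ^ r)"
          by (intro mult_mono bound power_mono) auto
        also have "\<dots> = real (m choose r) * C r / sg n * (1 + \<bar>c n k\<bar>) ^ (m - r + l + r)"
          by (simp add: power_add)
        also have "\<dots> \<le> real (m choose r) * C r / sg n * (1 + \<bar>c n k\<bar>) ^ P"
          using n C(1)[of r] r by (intro mult_left_mono power_increasing) (auto simp: P_def)
        finally show "norm (of_nat (m choose r) * of_real (c n k) ^ (m - r + l) *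
            (of_real (1 / sg n) ^ r * phi (A.T k ^ r) - of_real (q n) ^ r * of_real (semicircle_moment r)))
          \<le> real (m choose r) * C r / sg n * (1 + \<bar>c n k\<bar>) ^ P" .
      qed
      also have "\<dots> = C' / sg n * (1 + \<bar>c n k\<bar>) ^ P"
        by (simp only: C'_def sum_distrib_right sum_divide_distrib)
      finally show ?thesis .
    qed
    \<comment> \<open>Bounds the expectation of (1 + |c|)^P: the factor 2^P comes from
      \<open>one_plus_power_le\<close>, and \<open>D\<close> from the moment hypothesis, in which
      the powers of \<sigma> cancel.\<close>
    define E where "E = 2 ^ P * (1 + \<bar>al\<bar> ^ P * D)"
    have C'_nonneg: "C' \<ge> 0" unfolding C'_def using C(1) by (intro sum_nonneg) auto
    have "eventually (\<lambda>n. norm ((\<integral>w. F n (N n w) \<partial>M)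
        - (\<integral>w. G n (N n w) \<partial>M)) \<le> C' * E / sg n) sequentially"
      using sg_1 D(2) eventually_ge_at_top[of 1]
    proof eventually_elim
      case (elim n)
      have pg_h: "poly_growth (\<lambda>k. (1 + \<bar>c n k\<bar>) ^ P)"
        by (intro poly_growth_intros pg_c)
      have "norm ((\<integral>w. F n (N n w) \<partial>M) - (\<integral>w. G n (N n w) \<partial>M))
          \<le> C' / sg n * (\<integral>w. (1 + \<bar>c n (N n w)\<bar>) ^ P \<partial>M)"
        using elim by (intro norm_integral_diff_le int pg_F pg_G pg_h pointwise) auto
      also have "(\<integral>w. (1 + \<bar>c n (N n w)\<bar>) ^ P \<partial>M)
          \<le> (\<integral>w. 2 ^ P * (1 + \<bar>c n (N n w)\<bar> ^ P) \<partial>M)"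
      proof (rule Bochner_Integration.integral_mono)
        show "integrable M (\<lambda>w. 2 ^ P * (1 + \<bar>c n (N n w)\<bar> ^ P))"
          using elim by (intro int[of n "\<lambda>k. 2 ^ P
              * (1 + \<bar>c n k\<bar> ^ P)"] poly_growth_intros pg_c) auto
      qed (use elim in \<open>auto intro!: int pg_h one_plus_power_le\<close>)
      also have "\<dots> = (\<integral>w. 2 ^ P * (1 + \<bar>al\<bar> ^ P / sg n ^ P
          * \<bar>real (N n w) - et n\<bar> ^ P) \<partial>M)"
        using elim by (simp add: c_def power_divide power_mult_distrib abs_mult)
      also have "\<dots> = 2 ^ P * (1 + \<bar>al\<bar> ^ P / sg n ^ P
          * expectation (\<lambda>w. \<bar>real (N n w) - et n\<bar> ^ P))"
      proof -
        have "integrable M (\<lambda>w. \<bar>real (N n w) - et n\<bar> ^ P)"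
          using elim by (intro int[of n "\<lambda>k. \<bar>real k - et n\<bar> ^ P"] poly_growth_intros) auto
        then show ?thesis by (simp add: prob_space)
      qed
      also have "\<dots> \<le> 2 ^ P * (1 + \<bar>al\<bar> ^ P / sg n ^ P * (D * sg n ^ P))"
        using elim by (intro mult_left_mono add_left_mono) auto
      also have "\<dots> = E"
        using elim by (simp add: E_def)
      finally show ?case using elim C'_nonneg by (simp add: mult_left_mono divide_right_mono)
    qed
    moreover have "(\<lambda>n. C' * E / sg n) \<longlonglongrightarrow> 0"
      by (intro real_tendsto_divide_at_top[OF tendsto_const sg_top])
    ultimately have lim: "(\<lambda>n. (\<integral>w. F n (N n w) \<partial>M)
        - (\<integral>w. G n (N n w) \<partial>M)) \<longlonglongrightarrow> 0"
      by (rule Lim_null_comparison)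
    show "(\<lambda>n. ext_state M phi (\<lambda>w. rs_S_tilde scaleC phi a M N n w ^ m *
                               scalar_elem scaleC (rs_delta_N_tilde phi a M N n w) ^ l)
        - ext_state M psi (\<lambda>w.
            (scalar_elem scaleC' (rs_delta_N_tilde phi a M N n w) +
             scaleC' (complex_of_real (sqrt (1 - (rs_delta phi a M N n)\<^sup>2))) s) ^ m *
            scalar_elem scaleC' (rs_delta_N_tilde phi a M N n w) ^ l)) \<in> o(\<lambda>n. 1)"
      unfolding F G by (rule smalloI_tendsto) (use lim in simp_all)
  }

  \<comment> \<open>Part (ii): centred variables\<close>
  {
    assume hyp: "phi (a 1) = 0 \<and> rs_theta phi a > 0 \<and>
      filterlim (\<lambda>n. rs_eta M N n) at_top sequentially \<and>
      (\<forall>m\<ge>1. limsup (\<lambda>n. ereal (expectation (\<lambda>w. (real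
          (N n w) / rs_eta M N n) ^ m))) < \<infinity>)"
    define et where "et n = rs_eta M N n" for n
    have al: "al = 0" using hyp by (simp add: al_def rs_alpha_def)
    have th: "th > 0" using hyp by (simp add: th_def)
    have sg: "rs_sigma phi a M N n = th * sqrt (et n)" for n
      using al th by (simp add: rs_sigma_def al_def th_def et_def real_sqrt_mult)
    have et_top: "filterlim et at_top sequentially" using hyp by (simp add: et_def[abs_def])
    then have et_1: "eventually (\<lambda>n. et n \<ge> 1) sequentially"
      by (simp add: filterlim_at_top)

    fix m l :: nat
    define d where "d = (m - 1) div 2"
    obtain C where C: "C \<ge> 0" "\<And>et k. 1 \<le> et \<Longrightarrow> cmod (of_real (1 / (th
        * sqrt et)) ^ m * phi (A.T k ^ m) -
       of_real (semicircle_moment m * sqrt (real k / et) ^ m)) \<le> C / sqrt et * (real k / et) ^ d"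
      using A.normalized_moment_centred[of m] th unfolding th_def d_def by metis
    \<comment> \<open>A finite limsup bounds the moment only from some n on, which is enough.
      Exponent 0 lies outside the hypothesis, but there the expectation is that of the constant
      1.\<close>
    obtain D where D: "eventually (\<lambda>n. expectation (\<lambda>w. (real (N n w) / et n) ^ (l + d))
        \<le> D) sequentially"
    proof (cases "l + d = 0")
      case True
      then show thesis using that[of 1] by (simp add: prob_space)
    next
      case False
      then have "l + d \<ge> 1" by linarith
      then have "limsup (\<lambda>n. ereal (expectation (\<lambda>w. (real (N n w) / et n) ^
          (l + d)))) < \<infinity>"
        using hyp unfolding et_def by blast
      then obtain D where "limsup (\<lambda>n. ereal (expectation (\<lambda>w. (real (N n w) / et n) ^
          (l + d)))) < ereal D"
        using ereal_dense2 by blast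
      then have "eventually (\<lambda>n. ereal (expectation (\<lambda>w. (real (N n w) / et n) ^
          (l + d))) < ereal D) sequentially"
        by (rule Limsup_lessD)
      then show thesis by (intro that[of D]) (auto elim: eventually_mono)
    qed
    define F :: "nat \<Rightarrow> nat \<Rightarrow> complex" where "F n k
        = of_real (real k / et n) ^ l * (of_real (1 / (th * sqrt (et n))) ^ m * phi (A.T k ^ m))" for n k
    define G :: "nat \<Rightarrow> nat \<Rightarrow> complex" where "G n k
        = (of_real ((real k / et n) ^ l * (semicircle_moment m * sqrt (real k / et n) ^ m)) :: complex)" for n k
    have F: "ext_state M phi (\<lambda>w. rs_S_tilde scaleC phi a M N n w ^ m *
         scalar_elem scaleC (real (N n w) / rs_eta M N n) ^ l) = (\<integral>w. F n (N n w) \<partial>M)" for n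
    proof -
      have "rs_delta_N_tilde phi a M N n w = 0" for w
        using al by (simp add: rs_delta_N_tilde_def al_def)
      then show ?thesis
        unfolding ext_state_def A.rs_S_tilde_eq scalar_elem_def
        by (simp add: A.scaleC_one_power A.scale_power A.scaleC_mult_left A.scaleC_mult_right
            A.phi_scale F_def sg et_def mult.assoc)
    qed
    have G: "complex_of_real (expectation
              (\<lambda>w. rpow (real (N n w) / rs_eta M N n) (real l + real m / 2))) * psi (s ^ m)
                  = (\<integral>w. G n (N n w) \<partial>M)"
      if "et n \<ge> 1" for n
    proof -
      \<comment> \<open>At x = 0 both sides are 0 unless l = m = 0, when the convention in
        \<open>rpow\<close> makes the left side 1 like the product of natural powers.\<close>
      have "rpow x (real l + real m / 2) = x ^ l * sqrt x ^ m" if "x \<ge> 0" for x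
      proof (cases "x = 0 \<or> (l = 0 \<and> m = 0)")
        case False
        then have "x > 0" using that by auto
        then have "x powr (real l + real m / 2) = x powr real l * (x powr (1 / 2)) powr real m"
          by (simp add: powr_add powr_powr)
        then show ?thesis using False \<open>x > 0\<close> by (auto simp: rpow_def powr_realpow powr_half_sqrt)
      qed (auto simp: rpow_def power_0_left)
      then have "rpow (real (N n w) / rs_eta M N n) (real l + real m / 2) =
          (real (N n w) / et n) ^ l * sqrt (real (N n w) / et n) ^ m" for w
        using that by (simp add: et_def)
      then show ?thesis
        by (simp add: G_def psi_s mult_ac flip: of_real_mult)
    qed
    have pg_F: "poly_growth (F n)" and pg_G: "poly_growth (G n)" for n
      unfolding F_def G_def real_sqrt_divide unfolding divide_inverse
      by (intro poly_growth_intros A.poly_growth_phi_T)+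
    have pointwise: "norm (F n k - G n k) \<le> C / sqrt (et n)
        * (real k / et n) ^ (l + d)" if n: "et n \<ge> 1" for n k
    proof -
      have "F n k - G n k = of_real (real k / et n) ^ l * (of_real (1 / (th * sqrt (et n))) ^ m * phi (A.T k ^ m) -
       of_real (semicircle_moment m * sqrt (real k / et n) ^ m))"
        by (simp add: F_def G_def algebra_simps)
      also have "norm \<dots> \<le> (real k / et n) ^ l * (C / sqrt (et n) * (real k / et n) ^ d)"
        unfolding norm_mult norm_power norm_of_real using n by (intro mult_mono C(2)) auto
      finally show ?thesis by (simp add: power_add mult_ac)
    qed
    have "eventually (\<lambda>n. norm (ext_state M phi (\<lambda>w. rs_S_tilde scaleC phi a M N n w ^ m *
                               scalar_elem scaleC (real (N n w) / rs_eta M N n) ^ l)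
        - complex_of_real (expectation
              (\<lambda>w. rpow (real (N n w) / rs_eta M N n) (real l + real m / 2))) *
          psi (s ^ m)) \<le> C * D / sqrt (et n)) sequentially"
      using et_1 D eventually_ge_at_top[of 1]
    proof eventually_elim
      case (elim n)
      have pg_h: "poly_growth (\<lambda>k. (real k / et n) ^ (l + d))"
        unfolding divide_inverse by (intro poly_growth_intros)
      have "norm ((\<integral>w. F n (N n w) \<partial>M) - (\<integral>w. G n (N n w) \<partial>M))
          \<le> C / sqrt (et n) * expectation (\<lambda>w. (real (N n w) / et n) ^ (l + d))"
        using elim by (intro norm_integral_diff_le int pg_F pg_G pg_h pointwise) auto
      also have "\<dots> \<le> C / sqrt (et n) * D"
        using elim C(1) by (intro mult_left_mono) auto
      finally show ?case unfolding F G[OF elim(1)] by simp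
    qed
    moreover have "(\<lambda>n. C * D / sqrt (et n)) \<longlonglongrightarrow> 0"
      by (intro real_tendsto_divide_at_top[OF tendsto_const] filterlim_compose[OF sqrt_at_top et_top])
    ultimately have lim: "(\<lambda>n. ext_state M phi (\<lambda>w. rs_S_tilde scaleC phi a M N n w ^ m *
                               scalar_elem scaleC (real (N n w) / rs_eta M N n) ^ l)
        - complex_of_real (expectation
              (\<lambda>w. rpow (real (N n w) / rs_eta M N n) (real l + real m / 2))) *
          psi (s ^ m)) \<longlonglongrightarrow> 0"
      by (rule Lim_null_comparison)
    show "(\<lambda>n. ext_state M phi (\<lambda>w. rs_S_tilde scaleC phi a M N n w ^ m *
                               scalar_elem scaleC (real (N n w) / rs_eta M N n) ^ l)
        - complex_of_real (expectation
              (\<lambda>w. rpow (real (N n w) / rs_eta M N n) (real l + real m / 2))) *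
          psi (s ^ m)) \<in> o(\<lambda>n. 1)"
      by (rule smalloI_tendsto) (use lim in simp_all)
  }
qed

end
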